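(* Let $\mathcal{A}\in\mathbb{C}^{I_1\times\cdots\times I_M\times J_1\times\cdots\times J_N}$ and $\mathcal{B}\in\mathbb{C}^{J_1\times\cdots\times J_N\times K_1\times\cdots\times K_L}$. Let $\mathcal{M}\in\mathbb{C}^{I_1\times\cdots\times I_M\times I_1\times\cdots\times I_M}$, $\mathcal{N}\in\mathbb{C}^{J_1\times\cdots\times J_N\times J_1\times\cdots\times J_N}$ and $\mathcal{L}\in\mathbb{C}^{K_1\times\cdots\times K_L\times K_1\times\cdots\times K_L}$ be Hermitian positive definite tensors. Then $(\mathcal{A}*_N\mathcal{B})^{\dagger}_{\mathcal{M}\mathcal{L}}=\mathcal{B}^{\dagger}_{\mathcal{N}\mathcal{L}}*_N\mathcal{A}^{\dagger}_{\mathcal{M}\mathcal{N}}$ if and only if $$\mathcal{A}^{\dagger}_{\mathcal{M}\mathcal{N}}*_M\mathcal{A}*_N\mathcal{B}*_L\mathcal{B}^{\#}_{\mathcal{N}\mathcal{L}}*_N\mathcal{A}^{\#}_{\mathcal{M}\mathcal{N}}*_M\mathcal{A}*_N\mathcal{B}*_L\mathcal{B}^{\dagger}_{\mathcal{N}\mathcal{L}}=\mathcal{B}*_L\mathcal{B}^{\#}_{\mathcal{N}\mathcal{L}}*_N\mathcal{A}^{\#}_{\mathcal{M}\mathcal{N}}*_M\mathcal{A}.$$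
   Context: For $\mathcal{A}\in\mathbb{C}^{I_1\times\cdots\times I_M\times J_1\times\cdots\times J_N}$ and $\mathcal{B}\in\mathbb{C}^{J_1\times\cdots\times J_N\times K_1\times\cdots\times K_L}$ the Einstein product $*_N$ (contracting $N$ indices) is $(\mathcal{A}*_N\mathcal{B})_{i_1\cdots i_Mk_1\cdots k_L}=\sum_{j_1,\dots,j_N}a_{i_1\cdots i_Mj_1\cdots j_N}b_{j_1\cdots j_Nk_1\cdots k_L}$; $*_M,*_L,*_K$ are defined likewise. The conjugate transpose is $(\mathcal{A}^H)_{j_1\cdots j_Ni_1\cdots i_M}=\overline{a_{i_1\cdots i_Mj_1\cdots j_N}}$. In $\mathbb{C}^{I_1\times\cdots\times I_K\times I_1\times\cdots\times I_K}$: the identity tensor $\mathcal{I}$ has entries $\prod_k\delta_{i_kj_k}$; $\mathcal{U}$ is unitary if $\mathcal{U}*_K\mathcal{U}^H=\mathcal{U}^H*_K\mathcal{U}=\mathcal{I}$; $\mathcal{D}$ is diagonal if $d_{i_1\cdots i_Kj_1\cdots j_K}=0$ whenever $(i_1,\dots,i_K)\ne(j_1,\dots,j_K)$; $\mathcal{P}$ is Hermitian positive definite if $\mathcal{P}=\mathcal{U}*_K\mathcal{D}*_K\mathcal{U}^H$ with $\mathcal{U}$ unitary and $\mathcal{D}$ diagonal with positive diagonal entries; $\mathcal{P}^{-1}$ is the inverse with respect to $*_K$. For any $\mathcal{A}\in\mathbb{C}^{I_1\times\cdots\times I_M\times J_1\times\cdots\times J_N}$ and Hermitian positive definite $\mathcal{S}\in\mathbb{C}^{I_1\times\cdots\times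 I_M\times I_1\times\cdots\times I_M}$, $\mathcal{T}\in\mathbb{C}^{J_1\times\cdots\times J_N\times J_1\times\cdots\times J_N}$: the weighted conjugate transpose is $\mathcal{A}^{\#}_{\mathcal{S}\mathcal{T}}=\mathcal{T}^{-1}*_N\mathcal{A}^H*_M\mathcal{S}$, and the weighted Moore--Penrose inverse $\mathcal{A}^{\dagger}_{\mathcal{S}\mathcal{T}}$ is the unique $\mathcal{X}\in\mathbb{C}^{J_1\times\cdots\times J_N\times I_1\times\cdots\times I_M}$ satisfying $\mathcal{A}*_N\mathcal{X}*_M\mathcal{A}=\mathcal{A}$, $\mathcal{X}*_M\mathcal{A}*_N\mathcal{X}=\mathcal{X}$, $(\mathcal{S}*_M\mathcal{A}*_N\mathcal{X})^H=\mathcal{S}*_M\mathcal{A}*_N\mathcal{X}$, $(\mathcal{T}*_N\mathcal{X}*_M\mathcal{A})^H=\mathcal{T}*_N\mathcal{X}*_M\mathcal{A}$. *)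

theory Defs
  imports Complex_Main "HOL-Library.FuncSet"
begin

definition multi_indices :: "nat list \<Rightarrow> nat list set" where
  "multi_indices ds = listset (map (\<lambda>d. {1..d}) ds)"

lemma mem_multi_indices:
  "h \<in> multi_indices ds \<longleftrightarrow> length h = length ds \<and> (\<forall>k<length ds. 1 \<le> h ! k \<and> h ! k \<le> ds ! k)"
proof (induction ds arbitrary: h)
  case Nil
  then show ?case by (simp add: multi_indices_def)
next
  case (Cons d ds)
  then show ?case
    by (cases h) (auto simp: multi_indices_def set_Cons_def All_less_Suc2)
qed

lemma multi_indices_append:
  "i @ j \<in> multi_indices (ds @ es) \<longleftrightarrow> i \<in> multi_indices ds \<and> j \<in> multi_indices es"
  if "length i = length ds"
  using that
proof (induction i ds rule: list_induct2)
  case Nil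
  then show ?case by (simp add: multi_indices_def)
next
  case (Cons x xs y ys)
  then show ?case by (auto simp: multi_indices_def set_Cons_def)
qed

text \<open>A tensor is its list of dimensions together with its entries. Entries outside the index
  range are fixed to \<open>undefined\<close>, so that equality of tensors is equality of dimensions and entries.\<close>

typedef 'a tensor =
  "{(ds :: nat list, f :: nat list \<Rightarrow> 'a). f \<in> extensional (multi_indices ds)}"
  by (rule exI[of _ "([], restrict undefined (multi_indices []))"]) simp

definition dims :: "'a tensor \<Rightarrow> nat list" where
  "dims A = fst (Rep_tensor A)"

definition entry :: "'a tensor \<Rightarrow> nat list \<Rightarrow> 'a" (infixl "$$" 100) where
  "A $$ h = snd (Rep_tensor A) h"

definition tensor :: "nat list \<Rightarrow> (nat list \<Rightarrow> 'a) \<Rightarrow> 'a tensor" where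
  "tensor ds f = Abs_tensor (ds, restrict f (multi_indices ds))"

definition carrier_tensor :: "nat list \<Rightarrow> 'a tensor set" where
  "carrier_tensor ds = {A. dims A = ds}"

lemma dims_tensor [simp]: "dims (tensor ds f) = ds"
  by (simp add: dims_def tensor_def Abs_tensor_inverse)

lemma entry_tensor [simp]: "h \<in> multi_indices ds \<Longrightarrow> tensor ds f $$ h = f h"
  by (simp add: entry_def tensor_def Abs_tensor_inverse)

lemma tensor_eqI:
  assumes "dims A = dims B" and "\<And>h. h \<in> multi_indices (dims A) \<Longrightarrow> A $$ h = B $$ h"
  shows "A = B"
proof -
  have "snd (Rep_tensor A) \<in> extensional (multi_indices (dims A))"
    and "snd (Rep_tensor B) \<in> extensional (multi_indices (dims B))"
    using Rep_tensor[of A] Rep_tensor[of B] by (auto simp: dims_def)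
  with assms have "snd (Rep_tensor A) = snd (Rep_tensor B)"
    by (intro extensionalityI[of _ "multi_indices (dims A)"]) (auto simp: entry_def)
  with assms(1) show ?thesis
    by (simp add: dims_def Rep_tensor_inject prod_eq_iff flip: Rep_tensor_inject)
qed

text \<open>The Einstein product contracts the last \<open>N\<close> indices of \<open>A\<close> with the first \<open>N\<close> indices of \<open>B\<close>;
  it is meaningful only if the corresponding dimensions agree.\<close>

definition einstein :: "'a::semiring_0 tensor \<Rightarrow> nat \<Rightarrow> 'a tensor \<Rightarrow> 'a tensor"
    ("(_ \<star>\<^bsub>_\<^esub> _)" [70, 0, 71] 70) where
  "A \<star>\<^bsub>N\<^esub> B =
    (let M = length (dims A) - N in
      tensor (take M (dims A) @ drop N (dims B))
        (\<lambda>h. \<Sum>j\<in>multi_indices (take N (dims B)). A $$ (take M h @ j) * B $$ (j @ drop M h)))"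

text \<open>\<open>ctranspose M A\<close> regards the first \<open>M\<close> indices of \<open>A\<close> as row indices.\<close>

definition ctranspose :: "nat \<Rightarrow> complex tensor \<Rightarrow> complex tensor" where
  "ctranspose M A =
    (let N = length (dims A) - M in
      tensor (drop M (dims A) @ take M (dims A)) (\<lambda>h. cnj (A $$ (drop N h @ take N h))))"

lemma einstein_carrier:
  assumes "A \<in> carrier_tensor (Is @ Js)" and "B \<in> carrier_tensor (Js @ Ks)"
  shows "A \<star>\<^bsub>length Js\<^esub> B \<in> carrier_tensor (Is @ Ks)"
  using assms by (simp add: einstein_def carrier_tensor_def Let_def)

lemma einstein_entry:
  assumes "A \<in> carrier_tensor (Is @ Js)" and "B \<in> carrier_tensor (Js @ Ks)"
    and "i \<in> multi_indices Is" and "k \<in> multi_indices Ks"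
  shows "(A \<star>\<^bsub>length Js\<^esub> B) $$ (i @ k) = (\<Sum>j\<in>multi_indices Js. A $$ (i @ j) * B $$ (j @ k))"
proof -
  have "length i = length Is" using assms(3) by (simp add: mem_multi_indices)
  then show ?thesis
    using assms by (simp add: einstein_def carrier_tensor_def Let_def multi_indices_append)
qed

lemma ctranspose_carrier:
  assumes "A \<in> carrier_tensor (Is @ Js)"
  shows "ctranspose (length Is) A \<in> carrier_tensor (Js @ Is)"
  using assms by (simp add: ctranspose_def carrier_tensor_def Let_def)

lemma ctranspose_entry:
  assumes "A \<in> carrier_tensor (Is @ Js)" and "i \<in> multi_indices Is" and "j \<in> multi_indices Js"
  shows "ctranspose (length Is) A $$ (j @ i) = cnj (A $$ (i @ j))"
proof -
  have "length j = length Js" using assms(3) by (simp add: mem_multi_indices)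
  then show ?thesis
    using assms by (simp add: ctranspose_def carrier_tensor_def Let_def multi_indices_append)
qed

definition id_tensor :: "nat list \<Rightarrow> complex tensor" where
  "id_tensor Is =
    tensor (Is @ Is) (\<lambda>h. \<Prod>k<length Is. if h ! k = h ! (length Is + k) then 1 else 0)"

definition unitary_tensor :: "nat list \<Rightarrow> complex tensor \<Rightarrow> bool" where
  "unitary_tensor Is U \<longleftrightarrow>
    U \<in> carrier_tensor (Is @ Is) \<and>
    U \<star>\<^bsub>length Is\<^esub> ctranspose (length Is) U = id_tensor Is \<and>
    ctranspose (length Is) U \<star>\<^bsub>length Is\<^esub> U = id_tensor Is"

definition diagonal_tensor :: "nat list \<Rightarrow> complex tensor \<Rightarrow> bool" where
  "diagonal_tensor Is D \<longleftrightarrow>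
    D \<in> carrier_tensor (Is @ Is) \<and>
    (\<forall>i\<in>multi_indices Is. \<forall>j\<in>multi_indices Is. i \<noteq> j \<longrightarrow> D $$ (i @ j) = 0)"

definition hermitian_pos_def :: "nat list \<Rightarrow> complex tensor \<Rightarrow> bool" where
  "hermitian_pos_def Is P \<longleftrightarrow>
    (\<exists>U D. unitary_tensor Is U \<and> diagonal_tensor Is D \<and>
      (\<forall>i\<in>multi_indices Is. D $$ (i @ i) \<in> \<real> \<and> Re (D $$ (i @ i)) > 0) \<and>
      P = U \<star>\<^bsub>length Is\<^esub> D \<star>\<^bsub>length Is\<^esub> ctranspose (length Is) U)"

definition tensor_inv :: "nat list \<Rightarrow> complex tensor \<Rightarrow> complex tensor" where
  "tensor_inv Is P =
    (THE Q. Q \<in> carrier_tensor (Is @ Is) \<and>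
      P \<star>\<^bsub>length Is\<^esub> Q = id_tensor Is \<and> Q \<star>\<^bsub>length Is\<^esub> P = id_tensor Is)"

definition weighted_ctranspose ::
    "nat list \<Rightarrow> nat list \<Rightarrow> complex tensor \<Rightarrow> complex tensor \<Rightarrow> complex tensor \<Rightarrow> complex tensor" where
  "weighted_ctranspose Is Js S T A =
    tensor_inv Js T \<star>\<^bsub>length Js\<^esub> ctranspose (length Is) A \<star>\<^bsub>length Is\<^esub> S"

definition is_weighted_mp_inv ::
    "nat list \<Rightarrow> nat list \<Rightarrow> complex tensor \<Rightarrow> complex tensor \<Rightarrow> complex tensor \<Rightarrow> complex tensor \<Rightarrow> bool" where
  "is_weighted_mp_inv Is Js S T A X \<longleftrightarrow>
    (let M = length Is; N = length Js in
      X \<in> carrier_tensor (Js @ Is) \<and>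
      A \<star>\<^bsub>N\<^esub> X \<star>\<^bsub>M\<^esub> A = A \<and>
      X \<star>\<^bsub>M\<^esub> A \<star>\<^bsub>N\<^esub> X = X \<and>
      ctranspose M (S \<star>\<^bsub>M\<^esub> A \<star>\<^bsub>N\<^esub> X) = S \<star>\<^bsub>M\<^esub> A \<star>\<^bsub>N\<^esub> X \<and>
      ctranspose N (T \<star>\<^bsub>N\<^esub> X \<star>\<^bsub>M\<^esub> A) = T \<star>\<^bsub>N\<^esub> X \<star>\<^bsub>M\<^esub> A)"

definition weighted_mp_inv ::
    "nat list \<Rightarrow> nat list \<Rightarrow> complex tensor \<Rightarrow> complex tensor \<Rightarrow> complex tensor \<Rightarrow> complex tensor" where
  "weighted_mp_inv Is Js S T A = (THE X. is_weighted_mp_inv Is Js S T A X)"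

end

theory Submission
  imports Defs "HOL-Library.Function_Algebras"
begin

text \<open>A Hermitian positive definite weight factors as \<open>R\<^sup>H R\<close> with \<open>R\<close> invertible. Replacing \<open>A\<close> by
  \<open>R\<^sub>M A R\<^sub>N\<^sup>-\<^sup>1\<close> turns the weighted Moore--Penrose inverse and the weighted conjugate transpose into
  the ordinary ones, so the weights can be dropped. With the projections \<open>P = A\<^sup>\<dagger>A\<close>, \<open>Q = BB\<^sup>\<dagger>\<close>
  and \<open>E = BB\<^sup>H\<close>, \<open>F = A\<^sup>HA\<close>, the condition reads \<open>PEFQ = EF\<close>. It is equivalent to \<open>PEF = EF\<close> and
  \<open>EFQ = EF\<close>, hence to \<open>PE = EP\<close> and \<open>QF = FQ\<close>, which is Greville's criterion for the reverse order
  law. This part only uses that a tensor equals another one as soon as the four products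
  \<open>a\<^sup>Ha, a\<^sup>Hb, b\<^sup>Ha, b\<^sup>Hb\<close> agree, so no subtraction is needed; existence of Moore--Penrose inverses
  follows from a generalized inverse \<open>axa = a\<close> of a linear map.\<close>

section \<open>Moore--Penrose inverses in proper semigroups with involution\<close>

text \<open>Assumption \<open>proper\<close> is the subtraction-free form of the implication from
  \<open>(a - b)\<^sup>H (a - b) = 0\<close> to \<open>a = b\<close>. Associativity and the laws of
  the involution hold for all elements, so rewriting with them needs no membership in
  \<open>R\<close>.\<close>

locale proper_star_semigroup = semigroup mult
  for mult :: "'a \<Rightarrow> 'a \<Rightarrow> 'a" (infixl "\<cdot>" 70) +
  fixes star :: "'a \<Rightarrow> 'a" ("_\<^sup>H" [1000] 1000)
    and R :: "'a set"
  assumes mult_closed [simp]: "a \<in> R \<Longrightarrow> b \<in> R \<Longrightarrow> a \<cdot> b \<in> R"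
    and star_closed [simp]: "a \<in> R \<Longrightarrow> a\<^sup>H \<in> R"
    and star_star [simp]: "a\<^sup>H\<^sup>H = a"
    and star_mult: "(a \<cdot> b)\<^sup>H = b\<^sup>H \<cdot> a\<^sup>H"
    and proper: "\<lbrakk>a \<in> R; b \<in> R; a\<^sup>H \<cdot> b = a\<^sup>H \<cdot> a; b\<^sup>H \<cdot> a = a\<^sup>H \<cdot> a; b\<^sup>H \<cdot> b = a\<^sup>H \<cdot> a\<rbrakk> \<Longrightarrow> a = b"
    and regular: "a \<in> R \<Longrightarrow> \<exists>x\<in>R. a \<cdot> x \<cdot> a = a"
begin

section \<open>Cancellation laws and existence of Moore--Penrose inverses\<close>

definition mp_inverse :: "'a \<Rightarrow> 'a \<Rightarrow> bool" where
  "mp_inverse a x \<longleftrightarrow> x \<in> R \<and> a \<cdot> x \<cdot> a = a \<and> x \<cdot> a \<cdot> x = x \<and>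
    (a \<cdot> x)\<^sup>H = a \<cdot> x \<and> (x \<cdot> a)\<^sup>H = x \<cdot> a"

text \<open>Products are normalized to right-nested form by \<open>assoc\<close>, which hides a
  left-hand side \<open>a \<cdot> b\<close> that is followed by further factors. This is the variant
  of an equation that still matches there.\<close>

lemma assoc_rewrite: "a \<cdot> b = c \<Longrightarrow> a \<cdot> (b \<cdot> z) = c \<cdot> z"
  by (simp flip: assoc)

text \<open>The hypothesis and its adjoint turn all four products of \<open>a \<cdot> x\<close> and
  \<open>a \<cdot> y\<close> into the same element, so \<open>proper\<close> applies.\<close>

lemma star_cancel:
  assumes "a \<in> R" "x \<in> R" "y \<in> R" and eq: "a\<^sup>H \<cdot> (a \<cdot> x) = a\<^sup>H \<cdot> (a \<cdot> y)"
  shows "a \<cdot> x = a \<cdot> y"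
proof -
  have eq': "x\<^sup>H \<cdot> (a\<^sup>H \<cdot> a) = y\<^sup>H \<cdot> (a\<^sup>H \<cdot> a)"
    using arg_cong[OF eq, of star] by (simp add: star_mult assoc)
  show ?thesis
    using assms by - (rule proper, simp_all add: star_mult assoc assoc_rewrite[OF eq', simplified assoc])
qed

text \<open>Since \<open>p\<close> is a projection, \<open>(p g)\<^sup>H (p g)\<close> and both
  mixed products equal \<open>g\<^sup>H p g\<close>, hence \<open>g\<^sup>H g\<close>.
  Geometrically, a projection that preserves the norm of a vector fixes it.\<close>

lemma projection_absorb:
  assumes "p \<in> R" "g \<in> R" and p: "p\<^sup>H = p" "p \<cdot> p = p" and eq: "g\<^sup>H \<cdot> (p \<cdot> g) = g\<^sup>H \<cdot> g"
  shows "p \<cdot> g = g"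
  using assms by - (rule proper[symmetric], simp_all add: star_mult assoc assoc_rewrite[OF p(2)])

text \<open>The witness is \<open>x a\<^sup>H\<close>, where \<open>x\<close> is a generalized
  inverse of \<open>h = a\<^sup>H a\<close>. Properness lifts \<open>h x h = h\<close> to
  \<open>a x h = a\<close>, with adjoint \<open>a\<^sup>H = h x\<^sup>H a\<^sup>H\<close>.
  Substituting the latter into \<open>a x a\<^sup>H\<close> and collapsing \<open>a x h\<close>
  leaves \<open>a x\<^sup>H a\<^sup>H\<close>, so \<open>a x a\<^sup>H\<close> is
  self-adjoint.\<close>

lemma one_three_inverse:
  assumes a: "a \<in> R"
  obtains y where "y \<in> R" "a \<cdot> y \<cdot> a = a" "(a \<cdot> y)\<^sup>H = a \<cdot> y"
proof -
  define h where "h = a\<^sup>H \<cdot> a"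
  have h: "h \<in> R" "h\<^sup>H = h" using a by (simp_all add: h_def star_mult)
  have cancel: "a \<cdot> (x \<cdot> h) = a" if "x \<in> R" "h \<cdot> x \<cdot> h = h" for x
    proof (rule proper[symmetric])
    have ha: "a\<^sup>H \<cdot> (a \<cdot> z) = h \<cdot> z" for z by (simp add: h_def assoc)
    show "a\<^sup>H \<cdot> (a \<cdot> (x \<cdot> h)) = a\<^sup>H \<cdot> a" using that by (simp add: ha assoc) (simp add: h_def)
    have x': "h \<cdot> (x\<^sup>H \<cdot> h) = h" using arg_cong[OF that(2), of star] by (simp add: star_mult h assoc)
    have xh: "(a \<cdot> (x \<cdot> h))\<^sup>H = h \<cdot> (x\<^sup>H \<cdot> a\<^sup>H)" by (simp add: star_mult h assoc)
    show "(a \<cdot> (x \<cdot> h))\<^sup>H \<cdot> a = a\<^sup>H \<cdot> a" using x' by (simp add: xh assoc flip: h_def)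
    show "(a \<cdot> (x \<cdot> h))\<^sup>H \<cdot> (a \<cdot> (x \<cdot> h)) = a\<^sup>H \<cdot> a"
      using x' that by (simp add: xh assoc ha flip: h_def)
  qed (use a h that in simp_all)
  obtain x where x: "x \<in> R" "h \<cdot> x \<cdot> h = h" using regular[OF h(1)] by blast
  have x': "h \<cdot> x\<^sup>H \<cdot> h = h" using arg_cong[OF x(2), of star] by (simp add: star_mult h assoc)
  have c: "a \<cdot> (x \<cdot> h) = a" "a \<cdot> (x\<^sup>H \<cdot> h) = a" using cancel x x' by simp_all
  have c': "a\<^sup>H = h \<cdot> (x\<^sup>H \<cdot> a\<^sup>H)"
    using arg_cong[OF c(1), of star] by (simp add: star_mult h assoc)
  have "a \<cdot> (x \<cdot> a\<^sup>H) = a \<cdot> (x \<cdot> h) \<cdot> (x\<^sup>H \<cdot> a\<^sup>H)" by (subst c') (simp add: assoc)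
  also have "\<dots> = (a \<cdot> (x \<cdot> a\<^sup>H))\<^sup>H" by (simp add: c star_mult assoc)
  finally show ?thesis
    using x a c(1) by (intro that[of "x \<cdot> a\<^sup>H"]) (simp_all add: assoc h_def)
qed

text \<open>Let \<open>y\<close> be an inner inverse with \<open>a y\<close> self-adjoint, and
  \<open>z\<close> one with \<open>z a\<close> self-adjoint, the latter being the adjoint of such a
  \<open>y\<close> for \<open>a\<^sup>H\<close>. Then \<open>z a y\<close> keeps both symmetries,
  because \<open>a z a y = a y\<close> and \<open>z a y a = z a\<close>.\<close>

lemma mp_inverse_exists:
  assumes a: "a \<in> R"
  obtains x where "mp_inverse a x"
proof -
  obtain y where y: "y \<in> R" "a \<cdot> y \<cdot> a = a" "(a \<cdot> y)\<^sup>H = a \<cdot> y"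
    using one_three_inverse[OF a] .
  obtain w where w: "w \<in> R" "a\<^sup>H \<cdot> w \<cdot> a\<^sup>H = a\<^sup>H" "(a\<^sup>H \<cdot> w)\<^sup>H = a\<^sup>H \<cdot> w"
    using one_three_inverse[of "a\<^sup>H"] a by auto
  define z where "z = w\<^sup>H"
  have z: "z \<in> R" "a \<cdot> z \<cdot> a = a" "(z \<cdot> a)\<^sup>H = z \<cdot> a"
    using w(1) w(3)[symmetric] arg_cong[OF w(2), of star] by (simp_all add: z_def star_mult assoc)
  have e: "a \<cdot> (z \<cdot> a \<cdot> y) = a \<cdot> y" "z \<cdot> a \<cdot> y \<cdot> a = z \<cdot> a"
    using y(2) z(2) assoc_rewrite[OF z(2)[unfolded assoc]] by (simp_all add: assoc)
  have "mp_inverse a (z \<cdot> a \<cdot> y)"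
    unfolding mp_inverse_def e using y z a assoc_rewrite[OF z(2)[unfolded assoc]] by (simp add: assoc)
  then show ?thesis by (rule that)
qed

section \<open>Calculation rules and uniqueness of Moore--Penrose inverses\<close>

lemma mp_inverse_rules:
  assumes "mp_inverse a x"
  shows "a \<cdot> (x \<cdot> a) = a" "x \<cdot> (a \<cdot> x) = x"
    and "x\<^sup>H \<cdot> a\<^sup>H = a \<cdot> x" "a\<^sup>H \<cdot> x\<^sup>H = x \<cdot> a"
    and "x \<cdot> (a \<cdot> a\<^sup>H) = a\<^sup>H" "a\<^sup>H \<cdot> (a \<cdot> x) = a\<^sup>H"
proof -
  show 1: "a \<cdot> (x \<cdot> a) = a" "x \<cdot> (a \<cdot> x) = x"
    and 2: "x\<^sup>H \<cdot> a\<^sup>H = a \<cdot> x" "a\<^sup>H \<cdot> x\<^sup>H = x \<cdot> a"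
    using assms by (simp_all add: mp_inverse_def assoc star_mult)
  \<comment> \<open>This is the adjoint of \<open>a x a = a\<close>. Merging its last two factors
    into \<open>a x\<close>, or its first two into \<open>x a\<close>, gives the two remaining
    rules.\<close>
  have "a\<^sup>H \<cdot> (x\<^sup>H \<cdot> a\<^sup>H) = a\<^sup>H"
    using arg_cong[OF 1(1), of star] by (simp add: star_mult assoc)
  then show "a\<^sup>H \<cdot> (a \<cdot> x) = a\<^sup>H" "x \<cdot> (a \<cdot> a\<^sup>H) = a\<^sup>H"
    by (simp_all add: 2(1)) (simp add: assoc_rewrite[OF 2(2)] assoc flip: 2(1))
qed

lemmas mp_inverse_simps = mp_inverse_rules mp_inverse_rules[THEN assoc_rewrite, unfolded assoc]

text \<open>The adjoint of \<open>a x = (a y)(a x)\<close> swaps the two projections, and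
  \<open>(a x)(a y) = a y\<close>; hence \<open>a x = a y\<close>, and likewise
  \<open>x a = y a\<close>. Then \<open>x = x a x = x a y = y a y = y\<close>.\<close>

lemma mp_inverse_unique:
  assumes x: "mp_inverse a x" and y: "mp_inverse a y"
  shows "x = y"
proof -
  note simps = assoc star_mult mp_inverse_simps[OF x] mp_inverse_simps[OF y]
  have "a \<cdot> x = (a \<cdot> y \<cdot> (a \<cdot> x))\<^sup>H" by (simp add: simps)
  also have "\<dots> = a \<cdot> x \<cdot> (a \<cdot> y)"
    using x y by (simp add: star_mult[of "a \<cdot> y"] mp_inverse_def)
  also have "\<dots> = a \<cdot> y" by (simp add: simps)
  finally have 1: "a \<cdot> x = a \<cdot> y" .
  have "x \<cdot> a = (x \<cdot> a \<cdot> (y \<cdot> a))\<^sup>H" by (simp add: simps)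
  also have "\<dots> = y \<cdot> a \<cdot> (x \<cdot> a)"
    using x y by (simp add: star_mult[of "x \<cdot> a"] mp_inverse_def)
  also have "\<dots> = y \<cdot> a" by (simp add: simps)
  finally have 2: "x \<cdot> a = y \<cdot> a" .
  have "x = x \<cdot> (a \<cdot> x)" by (simp add: simps)
  also have "\<dots> = x \<cdot> a \<cdot> y" by (simp add: 1 assoc)
  also have "\<dots> = y" by (simp add: 2) (simp add: simps)
  finally show ?thesis .
qed

section \<open>Greville's criterion and the unweighted reverse order law\<close>

lemma mp_inverse_of_commuting:
  assumes a: "mp_inverse a x" and b: "mp_inverse b y"
    and P: "x \<cdot> a \<cdot> (b \<cdot> b\<^sup>H) = b \<cdot> b\<^sup>H \<cdot> (x \<cdot> a)"
    and Q: "b \<cdot> y \<cdot> (a\<^sup>H \<cdot> a) = a\<^sup>H \<cdot> a \<cdot> (b \<cdot> y)"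
  shows "mp_inverse (a \<cdot> b) (y \<cdot> x)"
proof -
  note simps = assoc star_mult mp_inverse_simps[OF a] mp_inverse_simps[OF b]
  note P' = P[unfolded assoc] assoc_rewrite[OF P, unfolded assoc]
    and Q' = Q[unfolded assoc] assoc_rewrite[OF Q, unfolded assoc]
  \<comment> \<open>The projection \<open>b \<cdot> y\<close> has the left factor \<open>b \<cdot> b\<^sup>H\<close>, with which \<open>x \<cdot> a\<close> commutes.\<close>
  have QE: "b \<cdot> y = b \<cdot> b\<^sup>H \<cdot> (y\<^sup>H \<cdot> y)" by (simp add: simps)
  have "x \<cdot> a \<cdot> (b \<cdot> y) = x \<cdot> a \<cdot> (b \<cdot> b\<^sup>H) \<cdot> (y\<^sup>H \<cdot> y)"
    by (subst QE) (simp only: assoc)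
  then have PQ: "x \<cdot> a \<cdot> (b \<cdot> y) = b \<cdot> b\<^sup>H \<cdot> (x \<cdot> a) \<cdot> (y\<^sup>H \<cdot> y)"
    by (simp only: P)
  have QPQ: "b \<cdot> y \<cdot> (x \<cdot> a \<cdot> (b \<cdot> y)) = x \<cdot> a \<cdot> (b \<cdot> y)"
    unfolding PQ by (simp add: simps)
  \<comment> \<open>The left side of \<open>QPQ\<close> is self-adjoint, so its right side is too:
    the projections \<open>x a\<close> and \<open>b y\<close> commute. The first two Penrose
    equations follow by swapping them.\<close>
  have com: "b \<cdot> (y \<cdot> (x \<cdot> a)) = x \<cdot> (a \<cdot> (b \<cdot> y))"
    using arg_cong[OF QPQ, of star] QPQ by (simp add: simps)
  note com = com assoc_rewrite[OF com, unfolded assoc]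
  \<comment> \<open>Writing \<open>a\<^sup>H\<close> as \<open>a\<^sup>H a x\<close> creates the
    factor \<open>a\<^sup>H a\<close>, past which \<open>b y\<close> can be moved by
    \<open>Q\<close>.\<close>
  have "(a \<cdot> b \<cdot> (y \<cdot> x))\<^sup>H = x\<^sup>H \<cdot> (b \<cdot> (y \<cdot> (a\<^sup>H \<cdot> a))) \<cdot> x" by (simp add: simps)
  also have "\<dots> = a \<cdot> b \<cdot> (y \<cdot> x)" by (simp add: Q') (simp add: simps)
  finally have 3: "(a \<cdot> b \<cdot> (y \<cdot> x))\<^sup>H = a \<cdot> b \<cdot> (y \<cdot> x)" .
  \<comment> \<open>Dually, \<open>b\<^sup>H = y b b\<^sup>H\<close> creates the factor
    \<open>b b\<^sup>H\<close>, past which \<open>x a\<close> can be moved by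
    \<open>P\<close>.\<close>
  have "(y \<cdot> x \<cdot> (a \<cdot> b))\<^sup>H = y \<cdot> (b \<cdot> (b\<^sup>H \<cdot> (x \<cdot> a))) \<cdot> y\<^sup>H" by (simp add: simps)
  also have "\<dots> = y \<cdot> x \<cdot> (a \<cdot> b)" by (simp flip: P') (simp add: simps)
  finally have 4: "(y \<cdot> x \<cdot> (a \<cdot> b))\<^sup>H = y \<cdot> x \<cdot> (a \<cdot> b)" .
  have "y \<cdot> (x \<cdot> (a \<cdot> (b \<cdot> (y \<cdot> x)))) = y \<cdot> (b \<cdot> (y \<cdot> (x \<cdot> (a \<cdot> x))))"
    by (simp only: com)
  then have "y \<cdot> x \<cdot> (a \<cdot> b) \<cdot> (y \<cdot> x) = y \<cdot> x" by (simp add: simps)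
  moreover have "a \<cdot> b \<cdot> (y \<cdot> x) \<cdot> (a \<cdot> b) = a \<cdot> b" by (simp add: assoc com) (simp add: simps)
  ultimately show ?thesis using 3 4 a b by (simp add: mp_inverse_def)
qed

theorem reverse_order_law:
  assumes R: "a \<in> R" "b \<in> R" and a: "mp_inverse a x" and b: "mp_inverse b y"
  shows "mp_inverse (a \<cdot> b) (y \<cdot> x) \<longleftrightarrow>
    x \<cdot> a \<cdot> b \<cdot> b\<^sup>H \<cdot> a\<^sup>H \<cdot> a \<cdot> b \<cdot> y = b \<cdot> b\<^sup>H \<cdot> a\<^sup>H \<cdot> a"
proof -
  note simps = assoc star_mult mp_inverse_simps[OF a] mp_inverse_simps[OF b]
  define P Q E F where "P = x \<cdot> a" and "Q = b \<cdot> y" and "E = b \<cdot> b\<^sup>H" and "F = a\<^sup>H \<cdot> a"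
  have xy: "x \<in> R" "y \<in> R" using a b by (auto simp: mp_inverse_def)
  have hP: "P\<^sup>H = P" "P \<cdot> P = P" "P \<in> R" using xy R by (simp_all add: P_def simps)
  have hQ: "Q\<^sup>H = Q" "Q \<cdot> Q = Q" "Q \<in> R" using xy R by (simp_all add: Q_def simps)
  have hE: "E\<^sup>H = E" "E \<in> R" and hF: "F\<^sup>H = F" "F \<in> R"
    using R by (simp_all add: E_def F_def star_mult)
  \<comment> \<open>Idempotence separates the condition: multiplying it by \<open>P\<close> on the
    left or by \<open>Q\<close> on the right leaves the side \<open>P E F Q\<close>
    unchanged.\<close>
  have split: "P \<cdot> (E \<cdot> (F \<cdot> Q)) = E \<cdot> F \<longleftrightarrow> P \<cdot> (E \<cdot> F) = E \<cdot> F \<and> E \<cdot> (F \<cdot> Q) = E \<cdot> F"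
  proof (intro iffI conjI)
    assume eq: "P \<cdot> (E \<cdot> (F \<cdot> Q)) = E \<cdot> F"
    show "P \<cdot> (E \<cdot> F) = E \<cdot> F" by (simp add: assoc_rewrite[OF hP(2)] flip: eq)
    have "E \<cdot> (F \<cdot> Q) = P \<cdot> (E \<cdot> (F \<cdot> Q)) \<cdot> Q" by (simp add: eq assoc)
    also have "\<dots> = P \<cdot> (E \<cdot> (F \<cdot> Q))" by (simp only: assoc hQ)
    also note eq
    finally show "E \<cdot> (F \<cdot> Q) = E \<cdot> F" .
  qed auto
  have "mp_inverse (a \<cdot> b) (y \<cdot> x) \<longleftrightarrow> P \<cdot> (E \<cdot> F) = E \<cdot> F \<and> E \<cdot> (F \<cdot> Q) = E \<cdot> F"
  proof (intro iffI conjI)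
    assume m: "mp_inverse (a \<cdot> b) (y \<cdot> x)"
    note s = mp_inverse_rules(5,6)[OF m]
    show "P \<cdot> (E \<cdot> F) = E \<cdot> F"
    proof -
      \<comment> \<open>The rule \<open>y x (a b)(a b)\<^sup>H = (a b)\<^sup>H\<close> is multiplied
        by \<open>a E b\<close> on the left. Because \<open>E Q = E\<close>, it becomes
        \<open>g\<^sup>H P g = g\<^sup>H g\<close> for this \<open>g\<close>. Multiplying the
        resulting \<open>P g = g\<close> by \<open>a\<close> on the right gives the goal.\<close>
      define g where "g = E \<cdot> a\<^sup>H"
      have gH: "g\<^sup>H = a \<cdot> E" by (simp add: g_def star_mult hE)
      have "a \<cdot> E \<cdot> b \<cdot> (y \<cdot> x \<cdot> (a \<cdot> b \<cdot> (a \<cdot> b)\<^sup>H)) = a \<cdot> E \<cdot> b \<cdot> (a \<cdot> b)\<^sup>H"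
        by (simp only: s)
      then have "g\<^sup>H \<cdot> (P \<cdot> g) = g\<^sup>H \<cdot> g"
        by (simp add: gH) (simp add: g_def E_def P_def simps)
      then have "P \<cdot> g = g" using hP hE R by - (rule projection_absorb, simp_all add: g_def)
      from arg_cong[OF this, of "\<lambda>z. z \<cdot> a"] show ?thesis by (simp add: g_def F_def assoc)
    qed
    show "E \<cdot> (F \<cdot> Q) = E \<cdot> F"
    proof -
      \<comment> \<open>Dual choice: \<open>(a b)\<^sup>H (a b)(y x) = (a b)\<^sup>H\<close> is
        multiplied by \<open>a F b\<close> on the right, and \<open>P F = F\<close> removes
        \<open>P\<close>.\<close>
      define g where "g = F \<cdot> b"
      have gH: "g\<^sup>H = b\<^sup>H \<cdot> F" by (simp add: g_def star_mult hF)
      have "(a \<cdot> b)\<^sup>H \<cdot> (a \<cdot> b \<cdot> (y \<cdot> x)) \<cdot> (a \<cdot> (F \<cdot> b)) = (a \<cdot> b)\<^sup>H \<cdot> (a \<cdot> (F \<cdot> b))"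
        by (simp only: s)
      then have "g\<^sup>H \<cdot> (Q \<cdot> g) = g\<^sup>H \<cdot> g"
        by (simp add: gH) (simp add: g_def F_def Q_def simps)
      then have "Q \<cdot> g = g" using hQ hF R by - (rule projection_absorb, simp_all add: g_def)
      from arg_cong[OF this, of star] have "b\<^sup>H \<cdot> (F \<cdot> Q) = b\<^sup>H \<cdot> F"
        by (simp add: star_mult gH hQ assoc)
      then show ?thesis by (simp add: E_def assoc)
    qed
  next
    assume eq: "P \<cdot> (E \<cdot> F) = E \<cdot> F \<and> E \<cdot> (F \<cdot> Q) = E \<cdot> F"
    \<comment> \<open>From \<open>F E P = F E\<close> a factor \<open>a\<^sup>H\<close> is
      cancelled, and multiplying by \<open>x\<close> gives \<open>P E P = P E\<close>. As
      \<open>P E P\<close> is self-adjoint, \<open>P\<close> and \<open>E\<close> commute. The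
      argument for \<open>Q\<close> and \<open>F\<close> is the same with \<open>b\<^sup>H\<close>
      in place of \<open>a\<close>.\<close>
    have "F \<cdot> (E \<cdot> P) = F \<cdot> E"
      using arg_cong[OF conjunct1[OF eq], of star] by (simp add: star_mult hP hE hF assoc)
    then have "a\<^sup>H \<cdot> (a \<cdot> (E \<cdot> P)) = a\<^sup>H \<cdot> (a \<cdot> E)" by (simp add: F_def assoc)
    then have "a \<cdot> (E \<cdot> P) = a \<cdot> E" using R hE hP by - (rule star_cancel, simp_all)
    then have PEP: "P \<cdot> (E \<cdot> P) = P \<cdot> E" by (simp add: P_def assoc)
    have "P \<cdot> (E \<cdot> P) = E \<cdot> P"
      using arg_cong[OF PEP, of star] by (simp add: star_mult hP hE assoc)
    with PEP have PE: "P \<cdot> E = E \<cdot> P" by simp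
    have "b \<cdot> (b\<^sup>H \<cdot> (F \<cdot> Q)) = b \<cdot> (b\<^sup>H \<cdot> F)" using eq by (simp add: E_def assoc)
    then have "b\<^sup>H \<cdot> (F \<cdot> Q) = b\<^sup>H \<cdot> F" using R hF hQ star_cancel[of "b\<^sup>H"] by simp
    then have "y\<^sup>H \<cdot> (b\<^sup>H \<cdot> (F \<cdot> Q)) = y\<^sup>H \<cdot> (b\<^sup>H \<cdot> F)" by simp
    then have QFQ: "Q \<cdot> (F \<cdot> Q) = Q \<cdot> F" by (simp add: Q_def simps)
    have "Q \<cdot> (F \<cdot> Q) = F \<cdot> Q"
      using arg_cong[OF QFQ, of star] by (simp add: star_mult hQ hF assoc)
    with QFQ have QF: "Q \<cdot> F = F \<cdot> Q" by simp
    show "mp_inverse (a \<cdot> b) (y \<cdot> x)"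
      using mp_inverse_of_commuting[OF a b] PE QF by (simp add: P_def Q_def E_def F_def)
  qed
  then show ?thesis using split by (simp add: P_def Q_def E_def F_def assoc)
qed

subsection \<open>Weighted inverses\<close>

definition weighted_mp_inverse :: "'a \<Rightarrow> 'a \<Rightarrow> 'a \<Rightarrow> 'a \<Rightarrow> bool" where
  "weighted_mp_inverse s t a x \<longleftrightarrow> x \<in> R \<and> a \<cdot> x \<cdot> a = a \<and> x \<cdot> a \<cdot> x = x \<and>
    (s \<cdot> a \<cdot> x)\<^sup>H = s \<cdot> a \<cdot> x \<and> (t \<cdot> x \<cdot> a)\<^sup>H = t \<cdot> x \<cdot> a"

text \<open>\<open>r\<close> and \<open>r'\<close> are mutually inverse in the corner monoid of the projection \<open>e\<close>.\<close>

definition unit_pair :: "'a \<Rightarrow> 'a \<Rightarrow> 'a \<Rightarrow> bool" where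
  "unit_pair e r r' \<longleftrightarrow> r \<in> R \<and> r' \<in> R \<and> e\<^sup>H = e \<and> r \<cdot> r' = e \<and> r' \<cdot> r = e \<and>
    e \<cdot> r = r \<and> e \<cdot> r' = r'"

lemma unit_pair_rules:
  assumes "unit_pair e r r'"
  shows "r \<cdot> r' = e" "r' \<cdot> r = e" "e \<cdot> r = r" "e \<cdot> r' = r'" "r \<cdot> e = r" "r' \<cdot> e = r'"
    and "e \<cdot> r'\<^sup>H = r'\<^sup>H" "e \<cdot> r\<^sup>H = r\<^sup>H" "r\<^sup>H \<cdot> r'\<^sup>H = e" "r'\<^sup>H \<cdot> r\<^sup>H = e"
    and "r'\<^sup>H \<cdot> e = r'\<^sup>H" "r\<^sup>H \<cdot> e = r\<^sup>H"
proof -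
  show 1: "r \<cdot> r' = e" "r' \<cdot> r = e" and 2: "e \<cdot> r = r" "e \<cdot> r' = r'"
    using assms by (auto simp: unit_pair_def)
  have e: "e\<^sup>H = e" using assms by (simp add: unit_pair_def)
  have "r \<cdot> (r' \<cdot> r) = r" using 1(1) 2(1) by (simp flip: assoc)
  then show 3: "r \<cdot> e = r" by (simp add: 1)
  have "r' \<cdot> (r \<cdot> r') = r'" using 1(2) 2(2) by (simp flip: assoc)
  then show 4: "r' \<cdot> e = r'" by (simp add: 1)
  show "e \<cdot> r'\<^sup>H = r'\<^sup>H" "e \<cdot> r\<^sup>H = r\<^sup>H" "r\<^sup>H \<cdot> r'\<^sup>H = e" "r'\<^sup>H \<cdot> r\<^sup>H = e"
    "r'\<^sup>H \<cdot> e = r'\<^sup>H" "r\<^sup>H \<cdot> e = r\<^sup>H"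
    using 1[THEN arg_cong, of star] 2[THEN arg_cong, of star] 3[THEN arg_cong, of star]
      4[THEN arg_cong, of star] by (simp_all add: star_mult e)
qed

lemmas unit_pair_simps = unit_pair_rules unit_pair_rules[THEN assoc_rewrite]

text \<open>Multiplication by \<open>r'\<close> on the left and \<open>t\<close> on the right undoes
  the transformation, since \<open>e\<close> and \<open>f\<close> act as identities on
  \<open>y\<close> and \<open>z\<close>.\<close>

lemma unit_pair_cancel:
  assumes r: "unit_pair e r r'" and t: "unit_pair f t t'"
    and y: "e \<cdot> y = y" "y \<cdot> f = y" and z: "e \<cdot> z = z" "z \<cdot> f = z"
  shows "r \<cdot> (y \<cdot> t') = r \<cdot> (z \<cdot> t') \<longleftrightarrow> y = z"
proof
  assume "r \<cdot> (y \<cdot> t') = r \<cdot> (z \<cdot> t')"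
  then have "r' \<cdot> (r \<cdot> (y \<cdot> t')) \<cdot> t = r' \<cdot> (r \<cdot> (z \<cdot> t')) \<cdot> t" by simp
  then show "y = z"
    by (simp add: assoc unit_pair_simps[OF r] unit_pair_simps[OF t] y z)
qed simp

text \<open>The congruence \<open>r\<^sup>H (_) r\<close> carries \<open>r y r'\<close> to
  \<open>r\<^sup>H r y\<close>, the congruence with \<open>r'\<close> carries it back, and
  congruences preserve self-adjointness. This trades symmetry with respect to the weight
  \<open>r\<^sup>H r\<close> for ordinary symmetry.\<close>

lemma unit_pair_hermitian:
  assumes r: "unit_pair e r r'" and y: "e \<cdot> y = y" "y \<cdot> e = y"
  shows "(r \<cdot> (y \<cdot> r'))\<^sup>H = r \<cdot> (y \<cdot> r') \<longleftrightarrow> (r\<^sup>H \<cdot> (r \<cdot> y))\<^sup>H = r\<^sup>H \<cdot> (r \<cdot> y)"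
proof
  have e: "e\<^sup>H = e" using r by (simp add: unit_pair_def)
  have yH: "e \<cdot> y\<^sup>H = y\<^sup>H" "y\<^sup>H \<cdot> e = y\<^sup>H"
    using y[THEN arg_cong, of star] by (simp_all add: star_mult e)
  note simps = assoc star_mult unit_pair_simps[OF r] y yH assoc_rewrite[OF y(1)] assoc_rewrite[OF y(2)]
    assoc_rewrite[OF yH(1)] assoc_rewrite[OF yH(2)]
  {
    assume "(r \<cdot> (y \<cdot> r'))\<^sup>H = r \<cdot> (y \<cdot> r')"
    then have "r\<^sup>H \<cdot> (r \<cdot> (y \<cdot> r'))\<^sup>H \<cdot> r = r\<^sup>H \<cdot> (r \<cdot> (y \<cdot> r')) \<cdot> r" by simp
    then show "(r\<^sup>H \<cdot> (r \<cdot> y))\<^sup>H = r\<^sup>H \<cdot> (r \<cdot> y)" by (simp add: simps)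
  next
    assume "(r\<^sup>H \<cdot> (r \<cdot> y))\<^sup>H = r\<^sup>H \<cdot> (r \<cdot> y)"
    then have "r'\<^sup>H \<cdot> (r\<^sup>H \<cdot> (r \<cdot> y))\<^sup>H \<cdot> r' = r'\<^sup>H \<cdot> (r\<^sup>H \<cdot> (r \<cdot> y)) \<cdot> r'" by simp
    then show "(r \<cdot> (y \<cdot> r'))\<^sup>H = r \<cdot> (y \<cdot> r')" by (simp add: simps)
  }
qed

text \<open>The weights are removed equation by equation: inner factors \<open>t' t\<close> and
  \<open>r' r\<close> collapse to corner identities. The first two Penrose equations transfer by
  \<open>unit_pair_cancel\<close>, the symmetry conditions by \<open>unit_pair_hermitian\<close>
  applied to \<open>a x\<close> and \<open>x a\<close>.\<close>

lemma weighted_mp_inverse_iff: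
  assumes r: "unit_pair e r r'" and t: "unit_pair f t t'"
    and a: "e \<cdot> a = a" "a \<cdot> f = a" and x: "x \<in> R" "f \<cdot> x = x" "x \<cdot> e = x"
  shows "weighted_mp_inverse (r\<^sup>H \<cdot> r) (t\<^sup>H \<cdot> t) a x \<longleftrightarrow> mp_inverse (r \<cdot> a \<cdot> t') (t \<cdot> x \<cdot> r')"
proof -
  note simps = assoc unit_pair_simps[OF r] unit_pair_simps[OF t] a x(2,3) assoc_rewrite[OF a(1)] assoc_rewrite[OF a(2)]
    assoc_rewrite[OF x(2)] assoc_rewrite[OF x(3)]
  have 1: "r \<cdot> a \<cdot> t' \<cdot> (t \<cdot> x \<cdot> r') \<cdot> (r \<cdot> a \<cdot> t') = r \<cdot> a \<cdot> t' \<longleftrightarrow> a \<cdot> x \<cdot> a = a"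
    using unit_pair_cancel[OF r t, of "a \<cdot> x \<cdot> a" a] by (simp add: simps)
  have 2: "t \<cdot> x \<cdot> r' \<cdot> (r \<cdot> a \<cdot> t') \<cdot> (t \<cdot> x \<cdot> r') = t \<cdot> x \<cdot> r' \<longleftrightarrow> x \<cdot> a \<cdot> x = x"
    using unit_pair_cancel[OF t r, of "x \<cdot> a \<cdot> x" x] by (simp add: simps)
  have 3: "(r \<cdot> a \<cdot> t' \<cdot> (t \<cdot> x \<cdot> r'))\<^sup>H = r \<cdot> a \<cdot> t' \<cdot> (t \<cdot> x \<cdot> r') \<longleftrightarrow>
      (r\<^sup>H \<cdot> r \<cdot> a \<cdot> x)\<^sup>H = r\<^sup>H \<cdot> r \<cdot> a \<cdot> x"
    using unit_pair_hermitian[OF r, of "a \<cdot> x"] by (simp add: simps)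
  have 4: "(t \<cdot> x \<cdot> r' \<cdot> (r \<cdot> a \<cdot> t'))\<^sup>H = t \<cdot> x \<cdot> r' \<cdot> (r \<cdot> a \<cdot> t') \<longleftrightarrow>
      (t\<^sup>H \<cdot> t \<cdot> x \<cdot> a)\<^sup>H = t\<^sup>H \<cdot> t \<cdot> x \<cdot> a"
    using unit_pair_hermitian[OF t, of "x \<cdot> a"] by (simp add: simps)
  have "t \<cdot> x \<cdot> r' \<in> R" using x r t by (simp add: unit_pair_def)
  then show ?thesis
    unfolding weighted_mp_inverse_def mp_inverse_def 1 2 3 4 using x by simp
qed

lemma weighted_mp_inverse_exists:
  assumes r: "unit_pair e r r'" and t: "unit_pair f t t'"
    and a: "a \<in> R" "e \<cdot> a = a" "a \<cdot> f = a"
  obtains x where "weighted_mp_inverse (r\<^sup>H \<cdot> r) (t\<^sup>H \<cdot> t) a x" "f \<cdot> x = x" "x \<cdot> e = x"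
proof -
  have R: "r \<in> R" "r' \<in> R" "t \<in> R" "t' \<in> R" using r t by (auto simp: unit_pair_def)
  obtain y where y: "mp_inverse (r \<cdot> a \<cdot> t') y"
    using mp_inverse_exists[of "r \<cdot> a \<cdot> t'"] R a by auto
  note simps = assoc unit_pair_simps[OF r] unit_pair_simps[OF t]
  have ef: "e\<^sup>H = e" "f\<^sup>H = f" using r t by (auto simp: unit_pair_def)
  \<comment> \<open>To transform \<open>y\<close> back it must lie in the corner given by
    \<open>f\<close> and \<open>e\<close>. It inherits this from \<open>(r a t')\<^sup>H\<close>,
    which can be split off on either side of \<open>y\<close>.\<close>
  have "y = (r \<cdot> a \<cdot> t')\<^sup>H \<cdot> (y\<^sup>H \<cdot> y)" using mp_inverse_rules[OF y] by (simp add: assoc_rewrite)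
  then have fy: "f \<cdot> y = y"
    using assoc_rewrite[of f "t'\<^sup>H" "t'\<^sup>H"] by (metis (no_types, lifting) assoc star_mult unit_pair_rules(7)[OF t])
  have "y = y \<cdot> (y\<^sup>H \<cdot> (r \<cdot> a \<cdot> t')\<^sup>H)" using mp_inverse_rules[OF y] by simp
  then have ye: "y \<cdot> e = y"
    by (metis (no_types, lifting) assoc star_mult unit_pair_rules(12)[OF r])
  define x where "x = t' \<cdot> y \<cdot> r"
  have x: "x \<in> R" "f \<cdot> x = x" "x \<cdot> e = x"
    using R y by (simp_all add: x_def simps mp_inverse_def)
  have "t \<cdot> x \<cdot> r' = y" using assoc_rewrite[OF fy] by (simp add: x_def simps fy ye)
  then have "weighted_mp_inverse (r\<^sup>H \<cdot> r) (t\<^sup>H \<cdot> t) a x"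
    using weighted_mp_inverse_iff[OF r t a(2,3) x] y by simp
  with x show ?thesis using that by blast
qed

lemma weighted_mp_inverse_unique:
  assumes r: "unit_pair e r r'" and t: "unit_pair f t t'"
    and a: "e \<cdot> a = a" "a \<cdot> f = a"
    and x: "weighted_mp_inverse (r\<^sup>H \<cdot> r) (t\<^sup>H \<cdot> t) a x" "f \<cdot> x = x" "x \<cdot> e = x"
    and y: "weighted_mp_inverse (r\<^sup>H \<cdot> r) (t\<^sup>H \<cdot> t) a y" "f \<cdot> y = y" "y \<cdot> e = y"
  shows "x = y"
proof -
  have "x \<in> R" "y \<in> R" using x y by (auto simp: weighted_mp_inverse_def)
  then have "t \<cdot> x \<cdot> r' = t \<cdot> y \<cdot> r'"
    using weighted_mp_inverse_iff[OF r t a] x y mp_inverse_unique by blast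
  then show ?thesis
    using unit_pair_cancel[OF t r] x y by (simp add: assoc)
qed

text \<open>One change of coordinates serves all three inverses: the middle factor
  \<open>t' t\<close> collapses, so \<open>A B = r (a b) u'\<close>. Since
  \<open>t' t'\<^sup>H\<close> inverts the weight \<open>t\<^sup>H t\<close>, the element
  \<open>a_adj\<close> corresponds to the ordinary adjoint, \<open>t a_adj r' = A\<^sup>H\<close>,
  and similarly for \<open>b_adj\<close>. Both sides of the condition are thereby conjugated by
  \<open>t\<close>.\<close>

theorem weighted_reverse_order_law:
  assumes r: "unit_pair e r r'" and t: "unit_pair f t t'" and u: "unit_pair g u u'"
    and a: "a \<in> R" "e \<cdot> a = a" "a \<cdot> f = a" and b: "b \<in> R" "f \<cdot> b = b" "b \<cdot> g = b"
    and x: "weighted_mp_inverse (r\<^sup>H \<cdot> r) (t\<^sup>H \<cdot> t) a x" "f \<cdot> x = x" "x \<cdot> e = x"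
    and y: "weighted_mp_inverse (t\<^sup>H \<cdot> t) (u\<^sup>H \<cdot> u) b y" "g \<cdot> y = y" "y \<cdot> f = y"
    and z: "weighted_mp_inverse (r\<^sup>H \<cdot> r) (u\<^sup>H \<cdot> u) (a \<cdot> b) z" "g \<cdot> z = z" "z \<cdot> e = z"
    and a_adj: "a_adj = t' \<cdot> t'\<^sup>H \<cdot> a\<^sup>H \<cdot> (r\<^sup>H \<cdot> r)"
    and b_adj: "b_adj = u' \<cdot> u'\<^sup>H \<cdot> b\<^sup>H \<cdot> (t\<^sup>H \<cdot> t)"
  shows "z = y \<cdot> x \<longleftrightarrow>
    x \<cdot> a \<cdot> b \<cdot> b_adj \<cdot> a_adj \<cdot> a \<cdot> b \<cdot> y = b \<cdot> b_adj \<cdot> a_adj \<cdot> a"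
proof -
  define A B X Y where "A = r \<cdot> a \<cdot> t'" and "B = t \<cdot> b \<cdot> u'" and "X = t \<cdot> x \<cdot> r'" and "Y = u \<cdot> y \<cdot> t'"
  have R: "A \<in> R" "B \<in> R" "x \<in> R" "y \<in> R" "z \<in> R"
    using r t u a(1) b(1) x(1) y(1) z(1) by (auto simp: A_def B_def unit_pair_def weighted_mp_inverse_def)
  have eH: "e\<^sup>H = e" "f\<^sup>H = f" "g\<^sup>H = g" using r t u by (auto simp: unit_pair_def)
  have aH: "a\<^sup>H \<cdot> e = a\<^sup>H" "f \<cdot> a\<^sup>H = a\<^sup>H" and bH: "b\<^sup>H \<cdot> f = b\<^sup>H" "g \<cdot> b\<^sup>H = b\<^sup>H"
    using a(2,3)[THEN arg_cong, of star] b(2,3)[THEN arg_cong, of star] by (simp_all add: star_mult eH)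
  note supp = a(2,3) b(2,3) x(2,3) y(2,3) z(2,3) aH bH
  note simps = assoc unit_pair_simps[OF r] unit_pair_simps[OF t] unit_pair_simps[OF u] supp supp[THEN assoc_rewrite]
  have X: "mp_inverse A X"
    using weighted_mp_inverse_iff[OF r t a(2,3) R(3) x(2,3)] x(1) by (simp add: A_def X_def)
  have Y: "mp_inverse B Y"
    using weighted_mp_inverse_iff[OF t u b(2,3) R(4) y(2,3)] y(1) by (simp add: B_def Y_def)
  have AB: "r \<cdot> (a \<cdot> b) \<cdot> u' = A \<cdot> B" by (simp add: A_def B_def simps)
  have YX: "Y \<cdot> X = u \<cdot> ((y \<cdot> x) \<cdot> r')" by (simp add: X_def Y_def simps)
  have Z: "mp_inverse (A \<cdot> B) (u \<cdot> (z \<cdot> r'))"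
    using weighted_mp_inverse_iff[OF r u _ _ R(5) z(2,3), of "a \<cdot> b"] z(1)
    by (simp add: AB[symmetric] simps)
  have "z = y \<cdot> x \<longleftrightarrow> u \<cdot> (z \<cdot> r') = Y \<cdot> X"
    unfolding YX by (rule unit_pair_cancel[OF u r, symmetric]) (simp_all add: simps)
  also have "\<dots> \<longleftrightarrow> mp_inverse (A \<cdot> B) (Y \<cdot> X)"
    using Z mp_inverse_unique by metis
  also have "\<dots> \<longleftrightarrow> X \<cdot> A \<cdot> B \<cdot> B\<^sup>H \<cdot> A\<^sup>H \<cdot> A \<cdot> B \<cdot> Y = B \<cdot> B\<^sup>H \<cdot> A\<^sup>H \<cdot> A"
    by (rule reverse_order_law[OF R(1,2) X Y])
  also have "X \<cdot> A \<cdot> B \<cdot> B\<^sup>H \<cdot> A\<^sup>H \<cdot> A \<cdot> B \<cdot> Y = t \<cdot> ((x \<cdot> a \<cdot> b \<cdot> b_adj \<cdot> a_adj \<cdot> a \<cdot> b \<cdot> y) \<cdot> t')"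
    by (simp add: A_def B_def X_def Y_def a_adj b_adj star_mult simps)
  also have "B \<cdot> B\<^sup>H \<cdot> A\<^sup>H \<cdot> A = t \<cdot> ((b \<cdot> b_adj \<cdot> a_adj \<cdot> a) \<cdot> t')"
    by (simp add: A_def B_def a_adj b_adj star_mult simps)
  also have "t \<cdot> ((x \<cdot> a \<cdot> b \<cdot> b_adj \<cdot> a_adj \<cdot> a \<cdot> b \<cdot> y) \<cdot> t') = t \<cdot> ((b \<cdot> b_adj \<cdot> a_adj \<cdot> a) \<cdot> t') \<longleftrightarrow>
      x \<cdot> a \<cdot> b \<cdot> b_adj \<cdot> a_adj \<cdot> a \<cdot> b \<cdot> y = b \<cdot> b_adj \<cdot> a_adj \<cdot> a"
    by (rule unit_pair_cancel[OF t t]) (simp_all add: simps)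
  finally show ?thesis .
qed

end

section \<open>Matrices indexed by a finite set\<close>

text \<open>All tensors are embedded into the square matrices over one finite index set \<open>S\<close>, extended by zero,
  so that the product is associative without side conditions on dimensions.\<close>

definition kernel_mult :: "'i set \<Rightarrow> ('i \<Rightarrow> 'i \<Rightarrow> complex) \<Rightarrow> ('i \<Rightarrow> 'i \<Rightarrow> complex) \<Rightarrow> 'i \<Rightarrow> 'i \<Rightarrow> complex" where
  "kernel_mult S f g = (\<lambda>i k. \<Sum>j\<in>S. f i j * g j k)"

definition kernel_star :: "('i \<Rightarrow> 'i \<Rightarrow> complex) \<Rightarrow> 'i \<Rightarrow> 'i \<Rightarrow> complex" where
  "kernel_star f = (\<lambda>i j. cnj (f j i))"

definition kernels_on :: "'i set \<Rightarrow> ('i \<Rightarrow> 'i \<Rightarrow> complex) set" where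
  "kernels_on S = {f. \<forall>i j. f i j \<noteq> 0 \<longrightarrow> i \<in> S \<and> j \<in> S}"

lemma kernel_mult_assoc:
  "kernel_mult S (kernel_mult S f g) h = kernel_mult S f (kernel_mult S g h)"
proof (intro ext)
  fix i l
  show "kernel_mult S (kernel_mult S f g) h i l = kernel_mult S f (kernel_mult S g h) i l"
    unfolding kernel_mult_def sum_distrib_right sum_distrib_left
    by (subst sum.swap) (simp add: mult.assoc)
qed

text \<open>The diagonal entries of the four products at \<open>j\<close> are inner products of the
  \<open>j\<close>-th columns, so expanding the squared norm of the difference of these columns
  gives 0. Rows outside \<open>S\<close> vanish anyway.\<close>

lemma kernel_proper:
  assumes S: "finite S" and a: "a \<in> kernels_on S" and b: "b \<in> kernels_on S"
    and ab: "kernel_mult S (kernel_star a) b = kernel_mult S (kernel_star a) a"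
    and ba: "kernel_mult S (kernel_star b) a = kernel_mult S (kernel_star a) a"
    and bb: "kernel_mult S (kernel_star b) b = kernel_mult S (kernel_star a) a"
  shows "a = b"
proof (intro ext)
  fix i j
  show "a i j = b i j"
  proof (cases "i \<in> S")
    case True
    let ?p = "\<lambda>f g. \<Sum>i\<in>S. cnj (f i j) * g i j"
    have p: "?p a b = ?p a a" "?p b a = ?p a a" "?p b b = ?p a a"
      using ab[THEN fun_cong, THEN fun_cong, of j j] ba[THEN fun_cong, THEN fun_cong, of j j]
        bb[THEN fun_cong, THEN fun_cong, of j j]
      by (simp_all add: kernel_mult_def kernel_star_def)
    have "complex_of_real (\<Sum>i\<in>S. (cmod (a i j - b i j))\<^sup>2) =
        (\<Sum>i\<in>S. cnj (a i j - b i j) * (a i j - b i j))"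
      by (simp add: complex_norm_square mult.commute del: of_real_power complex_cnj_diff)
    also have "\<dots> = ?p a a - ?p a b - ?p b a + ?p b b"
      by (simp add: algebra_simps sum.distrib sum_subtractf)
    also have "\<dots> = 0" by (simp add: p)
    finally have "(\<Sum>i\<in>S. (cmod (a i j - b i j))\<^sup>2) = 0" by (simp only: of_real_eq_0_iff)
    then show ?thesis using True S by (simp add: sum_nonneg_eq_0_iff)
  next
    case False
    then have "a i j = 0" "b i j = 0" using a b by (auto simp: kernels_on_def)
    then show ?thesis by simp
  qed
qed

text \<open>The linear map \<phi> given by \<open>a\<close> has a linear right inverse
  \<open>g\<close> on its range, so \<phi> g \<phi> = \<phi>. The matrix of \<open>g\<close> cut
  down to \<open>S\<close> is the generalized inverse; the cut is harmless because \<phi> reads only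
  coordinates in \<open>S\<close>.\<close>

lemma kernel_regular:
  fixes a :: "'i \<Rightarrow> 'i \<Rightarrow> complex"
  assumes S: "finite S" and a: "a \<in> kernels_on S"
  shows "\<exists>x\<in>kernels_on S. kernel_mult S (kernel_mult S a x) a = a"
proof -
  define scale :: "complex \<Rightarrow> ('i \<Rightarrow> complex) \<Rightarrow> 'i \<Rightarrow> complex" where "scale = (\<lambda>c v i. c * v i)"
  interpret V: vector_space scale
    by unfold_locales (auto simp: scale_def fun_eq_iff algebra_simps)
  interpret VV: vector_space_pair scale scale ..
  define \<phi> where "\<phi> v = (\<lambda>i. \<Sum>j\<in>S. a i j * v j)" for v
  have "Vector_Spaces.linear scale scale \<phi>"
    unfolding Vector_Spaces.linear_iff
    by (intro conjI V.vector_space_axioms) (auto simp: scale_def \<phi>_def fun_eq_iff distrib_left sum.distrib sum_distrib_left mult.left_commute)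
  from VV.linear_exists_right_inverse_on[OF this V.subspace_UNIV]
  obtain g where g: "Vector_Spaces.linear scale scale g" "\<And>v. \<phi> (g (\<phi> v)) = \<phi> v" by auto
  interpret g: Vector_Spaces.linear scale scale g by (rule g(1))
  define unit_vec :: "'i \<Rightarrow> 'i \<Rightarrow> complex" where "unit_vec j = (\<lambda>i. of_bool (i = j))" for j
  define x where "x i j = (if i \<in> S \<and> j \<in> S then g (unit_vec j) i else 0)" for i j
  \<comment> \<open>The space of all functions may be infinite-dimensional, but a vector supported
    on the finite set \<open>S\<close> is a finite combination of unit vectors, so on it
    \<open>g\<close> is given by the matrix \<open>x\<close>.\<close>
  have g_sum: "g w i = (\<Sum>j\<in>S. w j * x i j)" if w: "\<And>j. j \<notin> S \<Longrightarrow> w j = 0" and "i \<in> S" for w i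
  proof -
    have sum_apply: "(\<Sum>j\<in>S. f j) i = (\<Sum>j\<in>S. f j i)" for f :: "'i \<Rightarrow> 'i \<Rightarrow> complex" and i
      using S by induction auto
    have "w = (\<Sum>j\<in>S. scale (w j) (unit_vec j))"
      using w S by (auto simp: fun_eq_iff sum_apply scale_def unit_vec_def of_bool_def if_distrib cong: if_cong)
    then have "g w = g (\<Sum>j\<in>S. scale (w j) (unit_vec j))" by (rule arg_cong)
    also have "\<dots> = (\<Sum>j\<in>S. scale (w j) (g (unit_vec j)))" by (simp add: g.sum g.scale)
    finally show ?thesis using \<open>i \<in> S\<close> by (simp add: sum_apply scale_def x_def)
  qed
  have "kernel_mult S a (kernel_mult S x a) = a"
  proof (intro ext)
    fix i k
    show "kernel_mult S a (kernel_mult S x a) i k = a i k"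
    proof (cases "k \<in> S")
      case True
      then have col: "\<phi> (unit_vec k) = (\<lambda>i. a i k)"
        using S by (simp add: \<phi>_def unit_vec_def of_bool_def if_distrib cong: if_cong)
      have "a i k = \<phi> (g (\<lambda>i. a i k)) i" using g(2)[of "unit_vec k"] by (simp add: col)
      also have "\<dots> = (\<Sum>j\<in>S. a i j * (\<Sum>l\<in>S. a l k * x j l))"
        unfolding \<phi>_def using a by (intro sum.cong refl arg_cong2[of _ _ _ _ "(*)"] g_sum) (auto simp: kernels_on_def)
      finally show ?thesis by (simp add: kernel_mult_def mult.commute)
    next
      case False
      then have "a l k = 0" for l using a by (auto simp: kernels_on_def)
      then show ?thesis by (simp add: kernel_mult_def)
    qed
  qed
  moreover have "x \<in> kernels_on S" by (simp add: kernels_on_def x_def)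
  ultimately show ?thesis by (auto simp: kernel_mult_assoc)
qed

section \<open>Tensors as matrices\<close>

lemma finite_multi_indices [simp]: "finite (multi_indices ds)"
proof (induction ds)
  case (Cons d ds)
  have "multi_indices (d # ds) = (\<lambda>(x, xs). x # xs) ` ({1..d} \<times> multi_indices ds)"
    by (auto simp: multi_indices_def set_Cons_def)
  with Cons show ?case by simp
qed (simp add: multi_indices_def)

lemma multi_indices_appendE:
  assumes "h \<in> multi_indices (Is @ Js)"
  obtains i j where "h = i @ j" "i \<in> multi_indices Is" "j \<in> multi_indices Js"
proof -
  have "length (take (length Is) h) = length Is"
    using assms by (simp add: mem_multi_indices)
  from multi_indices_append[OF this, of "drop (length Is) h" Js] assms show ?thesis
    using that[of "take (length Is) h" "drop (length Is) h"] by simp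
qed

definition kernel :: "nat list \<Rightarrow> nat list \<Rightarrow> complex tensor \<Rightarrow> nat list \<Rightarrow> nat list \<Rightarrow> complex" where
  "kernel Is Js A = (\<lambda>i j. if i \<in> multi_indices Is \<and> j \<in> multi_indices Js then A $$ (i @ j) else 0)"

text \<open>With constant weight 1 this is the corner projection of the index set \<open>I\<close>,
  which plays the role of the identity tensor inside the larger matrices.\<close>

definition diag_kernel :: "'i set \<Rightarrow> ('i \<Rightarrow> complex) \<Rightarrow> 'i \<Rightarrow> 'i \<Rightarrow> complex" where
  "diag_kernel I c = (\<lambda>i j. if i = j \<and> i \<in> I then c i else 0)"

lemma kernel_inject:
  assumes "A \<in> carrier_tensor (Is @ Js)" "B \<in> carrier_tensor (Is @ Js)"
  shows "kernel Is Js A = kernel Is Js B \<longleftrightarrow> A = B"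
proof
  assume eq: "kernel Is Js A = kernel Is Js B"
  show "A = B"
  proof (rule tensor_eqI)
    fix h assume "h \<in> multi_indices (dims A)"
    then obtain i j where "h = i @ j" "i \<in> multi_indices Is" "j \<in> multi_indices Js"
      using assms by (auto simp: carrier_tensor_def elim: multi_indices_appendE)
    then show "A $$ h = B $$ h"
      using eq[THEN fun_cong, THEN fun_cong, of i j] by (simp add: kernel_def)
  qed (use assms in \<open>simp add: carrier_tensor_def\<close>)
qed simp

lemma kernel_ctranspose:
  assumes "A \<in> carrier_tensor (Is @ Js)"
  shows "kernel Js Is (ctranspose (length Is) A) = kernel_star (kernel Is Js A)"
  using ctranspose_entry[OF assms] by (auto simp: kernel_def kernel_star_def fun_eq_iff)

lemma kernel_id_tensor: "kernel Is Is (id_tensor Is) = diag_kernel (multi_indices Is) (\<lambda>_. 1)"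
proof (intro ext)
  fix i j
  show "kernel Is Is (id_tensor Is) i j = diag_kernel (multi_indices Is) (\<lambda>_. 1) i j"
  proof (cases "i \<in> multi_indices Is \<and> j \<in> multi_indices Is")
    case True
    then have len: "length i = length Is" "length j = length Is" by (auto simp: mem_multi_indices)
    have "id_tensor Is $$ (i @ j) =
        (\<Prod>k<length Is. if (i @ j) ! k = (i @ j) ! (length Is + k) then 1 else 0)"
      using True len by (simp add: id_tensor_def multi_indices_append)
    also have "\<dots> = (\<Prod>k<length Is. if i ! k = j ! k then 1 else 0)"
      using len by (intro prod.cong) (auto simp: nth_append)
    also have "\<dots> = (if i = j then 1 else 0)"
      using len by (auto simp: list_eq_iff_nth_eq)
    finally show ?thesis using True by (simp add: kernel_def diag_kernel_def)
  qed (auto simp: kernel_def diag_kernel_def)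
qed

lemma kernel_star_diag: "kernel_star (diag_kernel I c) = diag_kernel I (\<lambda>i. cnj (c i))"
  by (auto simp: kernel_star_def diag_kernel_def fun_eq_iff)

section \<open>The semigroup of kernels over one finite index set\<close>

locale finite_index =
  fixes S :: "'i set"
  assumes finite_S: "finite S"
begin

abbreviation kernel_times (infixl "\<cdot>" 70) where
  "f \<cdot> g \<equiv> kernel_mult S f g"

sublocale proper_star_semigroup "kernel_mult S" kernel_star "kernels_on S"
proof
  fix f g h :: "'i \<Rightarrow> 'i \<Rightarrow> complex"
  show "f \<cdot> g \<cdot> h = f \<cdot> (g \<cdot> h)" by (rule kernel_mult_assoc)
  show "kernel_star (kernel_star f) = f" by (simp add: kernel_star_def)
  show "kernel_star (f \<cdot> g) = kernel_star g \<cdot> kernel_star f"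
    by (simp add: kernel_star_def kernel_mult_def mult.commute)
  show "kernel_star f \<in> kernels_on S" if "f \<in> kernels_on S"
    using that by (auto simp: kernels_on_def kernel_star_def)
  show "f \<cdot> g \<in> kernels_on S" if "f \<in> kernels_on S" "g \<in> kernels_on S"
    using that unfolding kernels_on_def kernel_mult_def
    by (auto elim!: sum.not_neutral_contains_not_neutral)
qed (auto intro: kernel_proper kernel_regular finite_S)

lemma diag_kernel_mult:
  assumes "I \<subseteq> S"
  shows "diag_kernel I c \<cdot> f = (\<lambda>i k. if i \<in> I then c i * f i k else 0)"
    and "f \<cdot> diag_kernel I c = (\<lambda>i k. if k \<in> I then f i k * c k else 0)"
proof -
  have "(\<Sum>j\<in>S. (if i = j \<and> i \<in> I then c i else 0) * f j k) = (\<Sum>j\<in>S. if i = j then (if i \<in> I then c i * f i k else 0) else 0)"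
    for i k by (intro sum.cong) auto
  then show "diag_kernel I c \<cdot> f = (\<lambda>i k. if i \<in> I then c i * f i k else 0)"
    using assms finite_S by (auto simp: kernel_mult_def diag_kernel_def fun_eq_iff)
  have "(\<Sum>j\<in>S. f i j * (if j = k \<and> j \<in> I then c j else 0)) = (\<Sum>j\<in>S. if j = k then (if k \<in> I then f i k * c k else 0) else 0)"
    for i k by (intro sum.cong) auto
  then show "f \<cdot> diag_kernel I c = (\<lambda>i k. if k \<in> I then f i k * c k else 0)"
    using assms finite_S by (auto simp: kernel_mult_def diag_kernel_def fun_eq_iff)
qed

lemma diag_kernel_in: "I \<subseteq> S \<Longrightarrow> diag_kernel I c \<in> kernels_on S"
  by (auto simp: kernels_on_def diag_kernel_def)

lemma diag_kernel_mult_diag: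
  "I \<subseteq> S \<Longrightarrow> diag_kernel I c \<cdot> diag_kernel I d = diag_kernel I (\<lambda>i. c i * d i)"
  by (subst diag_kernel_mult) (auto simp: diag_kernel_def fun_eq_iff)

end

section \<open>Tensors as corner elements of the kernel semigroup\<close>

locale tensor_kernels = finite_index S for S :: "nat list set"
begin

text \<open>Extension by zero kills all terms with \<open>j\<close> outside
  \<open>multi_indices Js\<close>, so summing over \<open>S\<close> gives the Einstein sum.\<close>

lemma kernel_einstein:
  assumes "multi_indices Js \<subseteq> S"
    and "A \<in> carrier_tensor (Is @ Js)" "B \<in> carrier_tensor (Js @ Ks)"
  shows "kernel Is Ks (A \<star>\<^bsub>length Js\<^esub> B) = kernel Is Js A \<cdot> kernel Js Ks B"
proof (intro ext)
  fix i k
  have "(\<Sum>j\<in>S. kernel Is Js A i j * kernel Js Ks B j k) =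
      (\<Sum>j\<in>multi_indices Js. kernel Is Js A i j * kernel Js Ks B j k)"
    using assms(1) finite_S by (intro sum.mono_neutral_right) (auto simp: kernel_def)
  also have "\<dots> = kernel Is Ks (A \<star>\<^bsub>length Js\<^esub> B) i k"
    using einstein_entry[OF assms(2,3), of i k] by (auto simp: kernel_def intro!: sum.neutral)
  finally show "kernel Is Ks (A \<star>\<^bsub>length Js\<^esub> B) i k = (kernel Is Js A \<cdot> kernel Js Ks B) i k"
    by (simp add: kernel_mult_def)
qed

lemma kernel_support:
  assumes "multi_indices Is \<subseteq> S" "multi_indices Js \<subseteq> S"
  shows "kernel Is Js A \<in> kernels_on S"
    and "diag_kernel (multi_indices Is) (\<lambda>_. 1) \<cdot> kernel Is Js A = kernel Is Js A"
    and "kernel Is Js A \<cdot> diag_kernel (multi_indices Js) (\<lambda>_. 1) = kernel Is Js A"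
  using assms
  by (auto simp: kernels_on_def diag_kernel_mult kernel_def fun_eq_iff split: if_splits)

text \<open>A kernel fixed by both corner projections vanishes outside the block of
  \<open>Is\<close> and \<open>Js\<close>, hence is determined by entries that form a tensor. This
  carries inverses built in the semigroup back to tensors.\<close>

lemma kernel_surj:
  assumes "multi_indices Is \<subseteq> S" "multi_indices Js \<subseteq> S"
    and "diag_kernel (multi_indices Is) (\<lambda>_. 1) \<cdot> f = f" "f \<cdot> diag_kernel (multi_indices Js) (\<lambda>_. 1) = f"
  obtains A where "A \<in> carrier_tensor (Is @ Js)" "kernel Is Js A = f"
proof
  let ?A = "tensor (Is @ Js) (\<lambda>h. f (take (length Is) h) (drop (length Is) h))"
  show "?A \<in> carrier_tensor (Is @ Js)" by (simp add: carrier_tensor_def)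
  have f: "f i j = 0" if "\<not> (i \<in> multi_indices Is \<and> j \<in> multi_indices Js)" for i j
    using assms(3,4)[THEN fun_cong, THEN fun_cong, of i j] assms(1,2) that
    by (auto simp: diag_kernel_mult)
  show "kernel Is Js ?A = f"
  proof (intro ext)
    fix i j
    show "kernel Is Js ?A i j = f i j"
    proof (cases "i \<in> multi_indices Is \<and> j \<in> multi_indices Js")
      case True
      then have "length i = length Is" by (simp add: mem_multi_indices)
      with True show ?thesis by (simp add: kernel_def multi_indices_append)
    qed (auto simp: kernel_def f)
  qed
qed

section \<open>Hermitian positive definite weights and their inverses\<close>

lemma hermitian_pos_def_factor:
  assumes I: "multi_indices Is \<subseteq> S" and P: "hermitian_pos_def Is P"
  obtains r r' where "unit_pair (diag_kernel (multi_indices Is) (\<lambda>_. 1)) r r'"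
    "kernel_star r \<cdot> r = kernel Is Is P"
proof -
  define diag where "diag = diag_kernel (multi_indices Is)"
  obtain U D where U: "unitary_tensor Is U" and D: "diagonal_tensor Is D"
    and pos: "\<And>i. i \<in> multi_indices Is \<Longrightarrow> D $$ (i @ i) \<in> \<real> \<and> Re (D $$ (i @ i)) > 0"
    and P: "P = U \<star>\<^bsub>length Is\<^esub> D \<star>\<^bsub>length Is\<^esub> ctranspose (length Is) U"
    using assms(2) by (auto simp: hermitian_pos_def_def)
  \<comment> \<open>Here \<open>q\<close> and \<open>q'\<close> are the square root of
    \<open>D\<close> and its inverse. The factor of \<open>P\<close> is \<open>q u\<^sup>H\<close>
    with inverse \<open>u q'\<close>, as
    \<open>(q u\<^sup>H)\<^sup>H (q u\<^sup>H) = u d u\<^sup>H\<close>.\<close>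
  define u d q q' where "u = kernel Is Is U" and "d = kernel Is Is D"
    and "q = diag (\<lambda>i. of_real (sqrt (Re (D $$ (i @ i)))))"
    and "q' = diag (\<lambda>i. of_real (1 / sqrt (Re (D $$ (i @ i)))))"
  let ?e = "diag (\<lambda>_. 1)"
  have carr: "U \<in> carrier_tensor (Is @ Is)" "D \<in> carrier_tensor (Is @ Is)"
    using U D by (auto simp: unitary_tensor_def diagonal_tensor_def)
  note simps = carr einstein_carrier ctranspose_carrier kernel_einstein[OF I] kernel_ctranspose
  have "kernel Is Is (U \<star>\<^bsub>length Is\<^esub> ctranspose (length Is) U) = ?e"
    "kernel Is Is (ctranspose (length Is) U \<star>\<^bsub>length Is\<^esub> U) = ?e"
    using U by (auto simp: unitary_tensor_def kernel_id_tensor diag_def)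
  then have u: "u \<cdot> kernel_star u = ?e" "kernel_star u \<cdot> u = ?e"
    by (simp_all add: simps u_def)
  have uR: "u \<in> kernels_on S" "?e \<cdot> u = u" "u \<cdot> ?e = u"
    using kernel_support[OF I I] by (simp_all add: u_def diag_def)
  have d: "d = diag (\<lambda>i. D $$ (i @ i))"
    using D by (auto simp: d_def diag_def kernel_def diag_kernel_def diagonal_tensor_def fun_eq_iff)
  have qR: "q \<in> kernels_on S" "q' \<in> kernels_on S"
    using I by (simp_all add: q_def q'_def diag_def diag_kernel_in)
  have eH: "kernel_star ?e = ?e" and qH: "kernel_star q = q"
    by (simp_all add: diag_def q_def kernel_star_diag)
  have uH: "?e \<cdot> kernel_star u = kernel_star u" "kernel_star u \<cdot> ?e = kernel_star u"
    using uR(2,3)[THEN arg_cong, of kernel_star] by (simp_all add: star_mult eH)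
  \<comment> \<open>Realness of the diagonal entries enters here, since \<open>q\<close> is built
    from their real parts only.\<close>
  have qq: "q \<cdot> q = d"
    unfolding d q_def diag_def diag_kernel_mult_diag[OF I]
    using pos by (auto simp: diag_kernel_def fun_eq_iff complex_eq_iff complex_is_Real_iff less_imp_le)
  have eq: "?e \<cdot> q = q" "?e \<cdot> q' = q'"
    by (simp_all add: q_def q'_def diag_def diag_kernel_mult_diag[OF I])
  have qe: "q \<cdot> q' = ?e" "q' \<cdot> q = ?e"
    unfolding q_def q'_def diag_def diag_kernel_mult_diag[OF I]
    using pos by (force simp: diag_kernel_def fun_eq_iff simp flip: of_real_mult)+
  note rules = assoc star_mult u u[THEN assoc_rewrite] uR(2,3) uR(2,3)[THEN assoc_rewrite] uH uH[THEN assoc_rewrite]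
    eH qH eq eq[THEN assoc_rewrite] qe qe[THEN assoc_rewrite]
  have "kernel Is Is P = u \<cdot> (d \<cdot> kernel_star u)"
    by (simp add: P simps u_def d_def assoc)
  moreover have "unit_pair ?e (q \<cdot> kernel_star u) (u \<cdot> q')"
    using uR qR by (simp add: unit_pair_def rules)
  ultimately show ?thesis
    using that[of "q \<cdot> kernel_star u" "u \<cdot> q'"] by (simp add: rules diag_def[symmetric] qq[symmetric])
qed

text \<open>In the corner, \<open>r' r'\<^sup>H\<close> inverts \<open>r\<^sup>H r\<close>. A tensor
  with this kernel exists by \<open>kernel_surj\<close>, and multiplying the equation of any other
  inverse by \<open>r' r'\<^sup>H\<close> on the left identifies the two, which resolves the
  definite description.\<close>

lemma tensor_inv_kernel:
  assumes I: "multi_indices Is \<subseteq> S" and r: "unit_pair (diag_kernel (multi_indices Is) (\<lambda>_. 1)) r r'"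
    and P: "P \<in> carrier_tensor (Is @ Is)" "kernel Is Is P = kernel_star r \<cdot> r"
  shows "tensor_inv Is P \<in> carrier_tensor (Is @ Is)"
    and "kernel Is Is (tensor_inv Is P) = r' \<cdot> kernel_star r'"
proof -
  define e where "e = diag_kernel (multi_indices Is) (\<lambda>_. 1)"
  note rules = assoc unit_pair_simps[OF r, folded e_def]
  obtain Q where Q: "Q \<in> carrier_tensor (Is @ Is)" "kernel Is Is Q = r' \<cdot> kernel_star r'"
    using kernel_surj[OF I I, of "r' \<cdot> kernel_star r'"] by (auto simp: rules simp flip: e_def)
  have id: "id_tensor Is \<in> carrier_tensor (Is @ Is)" by (simp add: id_tensor_def carrier_tensor_def)
  have inv: "P \<star>\<^bsub>length Is\<^esub> Q' = id_tensor Is \<longleftrightarrow> kernel_star r \<cdot> (r \<cdot> kernel Is Is Q') = e"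
    "Q' \<star>\<^bsub>length Is\<^esub> P = id_tensor Is \<longleftrightarrow> kernel Is Is Q' \<cdot> (kernel_star r \<cdot> r) = e"
    if "Q' \<in> carrier_tensor (Is @ Is)" for Q'
    by (subst kernel_inject[of _ Is Is, symmetric];
        simp add: P that id einstein_carrier kernel_einstein[OF I] kernel_id_tensor e_def assoc)+
  have "tensor_inv Is P = Q"
    unfolding tensor_inv_def
  proof (rule the_equality)
    show "Q \<in> carrier_tensor (Is @ Is) \<and>
        P \<star>\<^bsub>length Is\<^esub> Q = id_tensor Is \<and> Q \<star>\<^bsub>length Is\<^esub> P = id_tensor Is"
      using Q by (simp add: inv rules)
  next
    fix Q' assume Q': "Q' \<in> carrier_tensor (Is @ Is) \<and>
        P \<star>\<^bsub>length Is\<^esub> Q' = id_tensor Is \<and> Q' \<star>\<^bsub>length Is\<^esub> P = id_tensor Is"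
    then have "r' \<cdot> (kernel_star r' \<cdot> (kernel_star r \<cdot> (r \<cdot> kernel Is Is Q'))) = r' \<cdot> (kernel_star r' \<cdot> e)"
      using inv(1)[of Q'] by simp
    moreover have "e \<cdot> kernel Is Is Q' = kernel Is Is Q'"
      using kernel_support[OF I I] by (simp add: e_def)
    ultimately have "kernel Is Is Q' = kernel Is Is Q"
      by (simp add: rules Q(2))
    then show "Q' = Q" using Q' Q(1) by (simp add: kernel_inject)
  qed
  with Q show "tensor_inv Is P \<in> carrier_tensor (Is @ Is)"
    "kernel Is Is (tensor_inv Is P) = r' \<cdot> kernel_star r'" by simp_all
qed

section \<open>Weighted inverses of tensors and the reverse order law\<close>

lemma is_weighted_mp_inv_iff:
  assumes I: "multi_indices Is \<subseteq> S" and J: "multi_indices Js \<subseteq> S"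
    and carr: "P \<in> carrier_tensor (Is @ Is)" "Q \<in> carrier_tensor (Js @ Js)" "A \<in> carrier_tensor (Is @ Js)"
  shows "is_weighted_mp_inv Is Js P Q A X \<longleftrightarrow> X \<in> carrier_tensor (Js @ Is) \<and>
    weighted_mp_inverse (kernel Is Is P) (kernel Js Js Q) (kernel Is Js A) (kernel Js Is X)"
proof (cases "X \<in> carrier_tensor (Js @ Is)")
  case X: True
  note simps = carr X einstein_carrier ctranspose_carrier kernel_einstein[OF I] kernel_einstein[OF J]
    kernel_ctranspose
  have "A \<star>\<^bsub>length Js\<^esub> X \<star>\<^bsub>length Is\<^esub> A = A \<longleftrightarrow>
      kernel Is Js A \<cdot> kernel Js Is X \<cdot> kernel Is Js A = kernel Is Js A"
    by (subst kernel_inject[of _ Is Js, symmetric]) (simp_all add: simps)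
  moreover have "X \<star>\<^bsub>length Is\<^esub> A \<star>\<^bsub>length Js\<^esub> X = X \<longleftrightarrow>
      kernel Js Is X \<cdot> kernel Is Js A \<cdot> kernel Js Is X = kernel Js Is X"
    by (subst kernel_inject[of _ Js Is, symmetric]) (simp_all add: simps)
  moreover have "ctranspose (length Is) (P \<star>\<^bsub>length Is\<^esub> A \<star>\<^bsub>length Js\<^esub> X) = P \<star>\<^bsub>length Is\<^esub> A \<star>\<^bsub>length Js\<^esub> X \<longleftrightarrow>
      kernel_star (kernel Is Is P \<cdot> kernel Is Js A \<cdot> kernel Js Is X) =
        kernel Is Is P \<cdot> kernel Is Js A \<cdot> kernel Js Is X"
    by (subst kernel_inject[of _ Is Is, symmetric]) (simp_all add: simps)
  moreover have "ctranspose (length Js) (Q \<star>\<^bsub>length Js\<^esub> X \<star>\<^bsub>length Is\<^esub> A) = Q \<star>\<^bsub>length Js\<^esub> X \<star>\<^bsub>length Is\<^esub> A \<longleftrightarrow>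
      kernel_star (kernel Js Js Q \<cdot> kernel Js Is X \<cdot> kernel Is Js A) =
        kernel Js Js Q \<cdot> kernel Js Is X \<cdot> kernel Is Js A"
    by (subst kernel_inject[of _ Js Js, symmetric]) (simp_all add: simps)
  ultimately show ?thesis
    using X kernel_support(1)[OF J I] by (simp add: is_weighted_mp_inv_def weighted_mp_inverse_def)
qed (simp add: is_weighted_mp_inv_def)

text \<open>The definite description denotes: the weighted inverse found in the semigroup lies in
  the right corner, so it comes from a tensor, and uniqueness there gives uniqueness among tensors
  because \<open>kernel\<close> is injective on a fixed shape.\<close>

lemma weighted_mp_inv_kernel:
  assumes I: "multi_indices Is \<subseteq> S" and J: "multi_indices Js \<subseteq> S"
    and r: "unit_pair (diag_kernel (multi_indices Is) (\<lambda>_. 1)) r r'"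
    and t: "unit_pair (diag_kernel (multi_indices Js) (\<lambda>_. 1)) t t'"
    and P: "P \<in> carrier_tensor (Is @ Is)" "kernel_star r \<cdot> r = kernel Is Is P"
    and Q: "Q \<in> carrier_tensor (Js @ Js)" "kernel_star t \<cdot> t = kernel Js Js Q"
    and A: "A \<in> carrier_tensor (Is @ Js)"
  shows "weighted_mp_inv Is Js P Q A \<in> carrier_tensor (Js @ Is)"
    and "weighted_mp_inverse (kernel_star r \<cdot> r) (kernel_star t \<cdot> t) (kernel Is Js A)
      (kernel Js Is (weighted_mp_inv Is Js P Q A))"
proof -
  note supp = kernel_support[OF I J, of A] and iff = is_weighted_mp_inv_iff[OF I J P(1) Q(1) A]
  obtain x where x: "weighted_mp_inverse (kernel_star r \<cdot> r) (kernel_star t \<cdot> t) (kernel Is Js A) x"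
      "diag_kernel (multi_indices Js) (\<lambda>_. 1) \<cdot> x = x" "x \<cdot> diag_kernel (multi_indices Is) (\<lambda>_. 1) = x"
    by (rule weighted_mp_inverse_exists[OF r t supp])
  obtain X where X: "X \<in> carrier_tensor (Js @ Is)" "kernel Js Is X = x"
    by (rule kernel_surj[OF J I x(2,3)])
  have "weighted_mp_inv Is Js P Q A = X"
    unfolding weighted_mp_inv_def
  proof (rule the_equality)
    show "is_weighted_mp_inv Is Js P Q A X" using X x by (simp add: iff P(2) Q(2))
  next
    fix Y assume "is_weighted_mp_inv Is Js P Q A Y"
    then have Y: "Y \<in> carrier_tensor (Js @ Is)"
      "weighted_mp_inverse (kernel_star r \<cdot> r) (kernel_star t \<cdot> t) (kernel Is Js A) (kernel Js Is Y)"
      by (simp_all add: iff P(2) Q(2))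
    then have "kernel Js Is Y = x"
      by (intro weighted_mp_inverse_unique[OF r t supp(2,3) _ _ _ x] kernel_support[OF J I])
    with X Y show "Y = X" by (simp flip: kernel_inject)
  qed
  with X x show "weighted_mp_inv Is Js P Q A \<in> carrier_tensor (Js @ Is)"
    "weighted_mp_inverse (kernel_star r \<cdot> r) (kernel_star t \<cdot> t) (kernel Is Js A)
      (kernel Js Is (weighted_mp_inv Is Js P Q A))" by simp_all
qed

theorem tensor_reverse_order_law:
  assumes I: "multi_indices Is \<subseteq> S" and J: "multi_indices Js \<subseteq> S" and K: "multi_indices Ks \<subseteq> S"
    and A: "A \<in> carrier_tensor (Is @ Js)" and B: "B \<in> carrier_tensor (Js @ Ks)"
    and P: "P \<in> carrier_tensor (Is @ Is)" "hermitian_pos_def Is P"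
    and Q: "Q \<in> carrier_tensor (Js @ Js)" "hermitian_pos_def Js Q"
    and W: "W \<in> carrier_tensor (Ks @ Ks)" "hermitian_pos_def Ks W"
  defines "X \<equiv> weighted_mp_inv Is Js P Q A" and "Y \<equiv> weighted_mp_inv Js Ks Q W B"
    and "A' \<equiv> weighted_ctranspose Is Js P Q A" and "B' \<equiv> weighted_ctranspose Js Ks Q W B"
  shows "weighted_mp_inv Is Ks P W (A \<star>\<^bsub>length Js\<^esub> B) = Y \<star>\<^bsub>length Js\<^esub> X \<longleftrightarrow>
    X \<star>\<^bsub>length Is\<^esub> A \<star>\<^bsub>length Js\<^esub> B \<star>\<^bsub>length Ks\<^esub> B' \<star>\<^bsub>length Js\<^esub> A'
      \<star>\<^bsub>length Is\<^esub> A \<star>\<^bsub>length Js\<^esub> B \<star>\<^bsub>length Ks\<^esub> Y =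
    B \<star>\<^bsub>length Ks\<^esub> B' \<star>\<^bsub>length Js\<^esub> A' \<star>\<^bsub>length Is\<^esub> A"
proof -
  obtain r r' where r: "unit_pair (diag_kernel (multi_indices Is) (\<lambda>_. 1)) r r'"
      "kernel_star r \<cdot> r = kernel Is Is P"
    by (rule hermitian_pos_def_factor[OF I P(2)])
  obtain t t' where t: "unit_pair (diag_kernel (multi_indices Js) (\<lambda>_. 1)) t t'"
      "kernel_star t \<cdot> t = kernel Js Js Q"
    by (rule hermitian_pos_def_factor[OF J Q(2)])
  obtain u u' where u: "unit_pair (diag_kernel (multi_indices Ks) (\<lambda>_. 1)) u u'"
      "kernel_star u \<cdot> u = kernel Ks Ks W"
    by (rule hermitian_pos_def_factor[OF K W(2)])
  have AB: "A \<star>\<^bsub>length Js\<^esub> B \<in> carrier_tensor (Is @ Ks)"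
    using A B by (simp add: einstein_carrier)
  define Z where "Z = weighted_mp_inv Is Ks P W (A \<star>\<^bsub>length Js\<^esub> B)"
  note X = weighted_mp_inv_kernel[OF I J r(1) t(1) P(1) r(2) Q(1) t(2) A, folded X_def]
  note Y = weighted_mp_inv_kernel[OF J K t(1) u(1) Q(1) t(2) W(1) u(2) B, folded Y_def]
  note Z = weighted_mp_inv_kernel[OF I K r(1) u(1) P(1) r(2) W(1) u(2) AB, folded Z_def]
  \<comment> \<open>The inverse weights have kernels \<open>t' t'\<^sup>H\<close> and
    \<open>u' u'\<^sup>H\<close>, which gives the weighted transposes the form required of
    \<open>a_adj\<close> and \<open>b_adj\<close>.\<close>
  note T = tensor_inv_kernel[OF J t(1) Q(1) t(2)[symmetric]]
  note U = tensor_inv_kernel[OF K u(1) W(1) u(2)[symmetric]]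
  note carriers = A B P(1) Q(1) W(1) X(1) Y(1) Z(1) T(1) U(1) einstein_carrier ctranspose_carrier
  note kernels = kernel_einstein[OF I] kernel_einstein[OF J] kernel_einstein[OF K] kernel_ctranspose
  have A': "A' \<in> carrier_tensor (Js @ Is)"
    "kernel Js Is A' = t' \<cdot> kernel_star t' \<cdot> kernel_star (kernel Is Js A) \<cdot> (kernel_star r \<cdot> r)"
    by (simp_all add: A'_def weighted_ctranspose_def carriers kernels T(2) r(2))
  have B': "B' \<in> carrier_tensor (Ks @ Js)"
    "kernel Ks Js B' = u' \<cdot> kernel_star u' \<cdot> kernel_star (kernel Js Ks B) \<cdot> (kernel_star t \<cdot> t)"
    by (simp_all add: B'_def weighted_ctranspose_def carriers kernels U(2) t(2))
  note simps = carriers A'(1) B'(1) kernels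
  have kAB: "kernel Is Ks (A \<star>\<^bsub>length Js\<^esub> B) = kernel Is Js A \<cdot> kernel Js Ks B"
    by (simp add: simps)
  have "Z = Y \<star>\<^bsub>length Js\<^esub> X \<longleftrightarrow> kernel Ks Is Z = kernel Ks Js Y \<cdot> kernel Js Is X"
    by (subst kernel_inject[of _ Ks Is, symmetric]) (simp_all add: simps)
  also have "\<dots> \<longleftrightarrow>
      kernel Js Is X \<cdot> kernel Is Js A \<cdot> kernel Js Ks B \<cdot> kernel Ks Js B' \<cdot> kernel Js Is A' \<cdot>
        kernel Is Js A \<cdot> kernel Js Ks B \<cdot> kernel Ks Js Y =
      kernel Js Ks B \<cdot> kernel Ks Js B' \<cdot> kernel Js Is A' \<cdot> kernel Is Js A"
    by (rule weighted_reverse_order_law[OF r(1) t(1) u(1)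
          kernel_support[OF I J] kernel_support[OF J K]
          X(2) kernel_support(2,3)[OF J I] Y(2) kernel_support(2,3)[OF K J]
          Z(2)[unfolded kAB] kernel_support(2,3)[OF K I] A'(2) B'(2)])
  also have "\<dots> \<longleftrightarrow>
      X \<star>\<^bsub>length Is\<^esub> A \<star>\<^bsub>length Js\<^esub> B \<star>\<^bsub>length Ks\<^esub> B' \<star>\<^bsub>length Js\<^esub> A' \<star>\<^bsub>length Is\<^esub> A
        \<star>\<^bsub>length Js\<^esub> B \<star>\<^bsub>length Ks\<^esub> Y =
      B \<star>\<^bsub>length Ks\<^esub> B' \<star>\<^bsub>length Js\<^esub> A' \<star>\<^bsub>length Is\<^esub> A"
    by (subst kernel_inject[of _ Js Js, symmetric]) (simp_all add: simps)
  finally show ?thesis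
    unfolding Z_def .
qed

end

theorem theorem4p9:
  fixes \<A> \<B> \<M> \<N> \<L> :: "complex tensor"
    and Is Js Ks :: "nat list"
    and M N L :: nat
  assumes "length Is = M" and "length Js = N" and "length Ks = L"
    and "\<A> \<in> carrier_tensor (Is @ Js)"
    and "\<B> \<in> carrier_tensor (Js @ Ks)"
    and "\<M> \<in> carrier_tensor (Is @ Is)" and "hermitian_pos_def Is \<M>"
    and "\<N> \<in> carrier_tensor (Js @ Js)" and "hermitian_pos_def Js \<N>"
    and "\<L> \<in> carrier_tensor (Ks @ Ks)" and "hermitian_pos_def Ks \<L>"
  shows "weighted_mp_inv Is Ks \<M> \<L> (\<A> \<star>\<^bsub>N\<^esub> \<B>) =
           weighted_mp_inv Js Ks \<N> \<L> \<B> \<star>\<^bsub>N\<^esub> weighted_mp_inv Is Js \<M> \<N> \<A>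
    \<longleftrightarrow>
      weighted_mp_inv Is Js \<M> \<N> \<A> \<star>\<^bsub>M\<^esub> \<A> \<star>\<^bsub>N\<^esub> \<B>
          \<star>\<^bsub>L\<^esub> weighted_ctranspose Js Ks \<N> \<L> \<B>
          \<star>\<^bsub>N\<^esub> weighted_ctranspose Is Js \<M> \<N> \<A>
          \<star>\<^bsub>M\<^esub> \<A> \<star>\<^bsub>N\<^esub> \<B> \<star>\<^bsub>L\<^esub> weighted_mp_inv Js Ks \<N> \<L> \<B> =
        \<B> \<star>\<^bsub>L\<^esub> weighted_ctranspose Js Ks \<N> \<L> \<B>
          \<star>\<^bsub>N\<^esub> weighted_ctranspose Is Js \<M> \<N> \<A> \<star>\<^bsub>M\<^esub> \<A>"
proof -
  \<comment> \<open>Any finite set containing the three index sets would do. They may overlap, since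
    the shape of a tensor is recorded by its corner projections and not by \<open>S\<close>.\<close>
  define S where "S = multi_indices Is \<union> multi_indices Js \<union> multi_indices Ks"
  interpret tensor_kernels S by standard (simp add: S_def)
  show ?thesis
    unfolding assms(1-3)[symmetric]
    by (rule tensor_reverse_order_law) (use assms in \<open>simp_all add: S_def subset_iff\<close>)
qed

end
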